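(* Let $\nu>-\frac12$ and let $\mathbf{m}=\begin{pmatrix}a&b\\c&d\end{pmatrix}\in SL(2,\mathbb{R})$ with $b\neq0$. (i) For all $f\in\mathcal{C}_{*,0}(\mathbb{R})$, $\displaystyle\lim_{y\to0}\left\|T_y^{\nu,\mathbf{m}}f-f\right\|_\infty=0$. (ii) For all $1\le p<+\infty$ and all $f\in\mathcal{L}_{p,\nu}$, $\displaystyle\lim_{y\to0}\left\|T_y^{\nu,\mathbf{m}}f-f\right\|_{p,\nu}=0$.
   Context: $\mathcal{C}_{*,0}(\mathbb{R})$ is the space of even continuous functions on $\mathbb{R}$ vanishing at infinity, with the sup norm $\|\cdot\|_\infty$. $\mathcal{L}_{p,\nu}$ is the Lebesgue space on $[0,+\infty[$ with norm $\|f\|_{p,\nu}=\left(\int_0^{+\infty}|f(y)|^py^{2\nu+1}dy\right)^{1/p}$. For continuous $f$, the Bessel translation is $T_y^\nu f(x)=\frac{\Gamma(\nu+1)}{\sqrt\pi\,\Gamma(\nu+1/2)}\int_0^\pi f\left(\sqrt{x^2+y^2-2xy\cos\theta}\right)(\sin\theta)^{2\nu}d\theta$; it is even in $x$ and in $y$. The same formula defines, for each $y$, a contraction $f\mapsto T_y^\nu f$ of $\mathcal{L}_{p,\nu}$ (with $T_y^\nu f(x)$ defined for almost every $x\ge0$). The translation associated with $\mathbf{m}$ is $$T_y^{\nu,\mathbf{m}}f(x)=e^{\frac{i}{2}\frac{d}{b}(x^2+y^2)}T_y^\nu\left[s\mapsto e^{-\frac{i}{2}\frac{d}{b}s^2}f(s)\right](x).$$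 *)

theory Defs
  imports "HOL-Analysis.Analysis"
begin

text \<open>The space of even continuous complex-valued functions on the real line that vanish
  at infinity, and the sup norm on the whole line. The norm is extended-valued, so that an
  unbounded function has norm \<open>\<infinity>\<close>.\<close>

definition even_C0 :: "(real \<Rightarrow> complex) set" where
  "even_C0 = {f. (\<forall>x. f (- x) = f x) \<and> continuous_on UNIV f \<and> (f \<longlongrightarrow> 0) at_infinity}"

definition sup_norm :: "(real \<Rightarrow> complex) \<Rightarrow> ennreal" where
  "sup_norm f = (SUP x. ennreal (norm (f x)))"

definition bessel_measure :: "real \<Rightarrow> real measure" where
  "bessel_measure \<nu> = density (lebesgue_on {0..}) (\<lambda>y. ennreal (y powr (2 * \<nu> + 1)))"

text \<open>Elements of the Lebesgue space are represented by functions on the whole real line;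
  their values on the negative half-line play no role. The real-valued norm below is
  meaningful for members of \<open>Lp_bessel p \<nu>\<close> only, since the Bochner integral of a
  non-integrable function is 0.\<close>

definition Lp_bessel :: "real \<Rightarrow> real \<Rightarrow> (real \<Rightarrow> complex) set" where
  "Lp_bessel p \<nu> = {f. f \<in> borel_measurable (bessel_measure \<nu>)
      \<and> integrable (bessel_measure \<nu>) (\<lambda>y. norm (f y) powr p)}"

definition Lp_bessel_norm :: "real \<Rightarrow> real \<Rightarrow> (real \<Rightarrow> complex) \<Rightarrow> real" where
  "Lp_bessel_norm p \<nu> f = (\<integral>y. norm (f y) powr p \<partial>bessel_measure \<nu>) powr (1 / p)"

text \<open>The integral is taken with respect to \<open>lebesgue\<close> rather than \<open>lborel\<close> because \<open>f\<close> may be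
  merely Lebesgue measurable. For a member of a Lebesgue space the integrand is integrable
  for almost every \<open>x \<ge> 0\<close>; for the remaining \<open>x\<close> the value is the junk value 0.\<close>

definition bessel_translation ::
    "real \<Rightarrow> real \<Rightarrow> (real \<Rightarrow> complex) \<Rightarrow> real \<Rightarrow> complex" where
  "bessel_translation \<nu> y f x =
     complex_of_real (Gamma (\<nu> + 1) / (sqrt pi * Gamma (\<nu> + 1 / 2))) *
     (LINT \<theta>:{0..pi}|lebesgue.
        f (sqrt (x\<^sup>2 + y\<^sup>2 - 2 * x * y * cos \<theta>)) * complex_of_real (sin \<theta> powr (2 * \<nu>)))"

text \<open>For a matrix with rows \<open>(a, b)\<close> and \<open>(c, d)\<close>, \<open>m $ 1 $ 2\<close> is \<open>b\<close> and \<open>m $ 2 $ 2\<close> is \<open>d\<close>.\<close>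

definition canonical_translation ::
    "real \<Rightarrow> real^2^2 \<Rightarrow> real \<Rightarrow> (real \<Rightarrow> complex) \<Rightarrow> real \<Rightarrow> complex" where
  "canonical_translation \<nu> m y f x =
     (let b = m $ 1 $ 2; d = m $ 2 $ 2 in
        exp (\<i> / 2 * complex_of_real (d / b * (x\<^sup>2 + y\<^sup>2))) *
        bessel_translation \<nu> y (\<lambda>s. exp (- (\<i> / 2) * complex_of_real (d / b * s\<^sup>2)) * f s) x)"

end

theory Submission
  imports Defs
begin

text \<open>
  The translation associated with a matrix is the Bessel translation conjugated by multiplication
  with a function of modulus \<open>1\<close>, up to a phase factor which depends on \<open>y\<close> alone and tends to \<open>1\<close> as
  \<open>y\<close> tends to \<open>0\<close> (\<open>canonical_translation_diff\<close>). Both limits therefore reduce to limits for the Bessel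
  translation \<open>T\<close>.

  The normalised weight \<open>sin \<theta> powr (2 * \<nu>)\<close> is a probability density on \<open>[0, \<pi>]\<close>, so \<open>T f x\<close> is an
  average of values of \<open>f\<close> at chords, whose lengths differ from \<open>\<bar>x\<bar>\<close> by at most \<open>\<bar>y\<bar>\<close>. An even continuous
  function that vanishes at infinity is uniformly continuous, which gives the limit in the sup norm at
  once (\<open>angular_average_uniform\<close>).

  For the Lebesgue spaces the essential fact is that averaging preserves integrals
  (\<open>nn_integral_bessel_average\<close>): the average over \<open>\<theta>\<close> of \<open>h\<close> at the chord, integrated over \<open>x\<close> against
  \<open>x powr (2 * \<nu> + 1)\<close>, equals the integral of \<open>h\<close>. Indeed \<open>(x, \<theta>)\<close> are polar coordinates in the upper
  half-plane, the weight becomes \<open>v powr (2 * \<nu>)\<close> in the Cartesian coordinates \<open>(u, v)\<close>, and the chord is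
  the distance to the point \<open>(- y, 0)\<close>; so \<open>y\<close> disappears by a shift in \<open>u\<close>. With Jensen's
  inequality, \<open>T\<close> is a contraction for every \<open>p \<ge> 1\<close> (\<open>Lp_energy_average_le\<close>). For compactly supported
  continuous functions the limit follows from uniform continuity, and the contraction property carries it
  over to their closure, which is the whole space (\<open>Lp_continuous_dense\<close>).
\<close>

section \<open>The law of cosines\<close>

text \<open>The side opposite the angle \<open>\<theta>\<close> in a triangle with sides \<open>x\<close> and \<open>y\<close> (law of cosines): the
  point at which the translation evaluates its function.\<close>

definition chord :: "real \<Rightarrow> real \<Rightarrow> real \<Rightarrow> real" where
  "chord y x \<theta> = sqrt (x\<^sup>2 + y\<^sup>2 - 2 * x * y * cos \<theta>)"

lemma
  fixes x y \<theta> :: real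
  shows chord_radicand_ge: "(\<bar>x\<bar> - \<bar>y\<bar>)\<^sup>2 \<le> x\<^sup>2 + y\<^sup>2 - 2 * x * y * cos \<theta>"
    and chord_radicand_le: "x\<^sup>2 + y\<^sup>2 - 2 * x * y * cos \<theta> \<le> (\<bar>x\<bar> + \<bar>y\<bar>)\<^sup>2"
proof -
  have "\<bar>x * y * cos \<theta>\<bar> \<le> \<bar>x\<bar> * \<bar>y\<bar>"
    using mult_left_mono[OF abs_cos_le_one[of \<theta>], of "\<bar>x\<bar> * \<bar>y\<bar>"] by (simp add: abs_mult)
  thus "(\<bar>x\<bar> - \<bar>y\<bar>)\<^sup>2 \<le> x\<^sup>2 + y\<^sup>2 - 2 * x * y * cos \<theta>"
    and "x\<^sup>2 + y\<^sup>2 - 2 * x * y * cos \<theta> \<le> (\<bar>x\<bar> + \<bar>y\<bar>)\<^sup>2"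
    by (auto simp: power2_diff power2_sum abs_le_iff)
qed

text \<open>The triangle inequality for that triangle. It is what makes a translation by a small \<open>y\<close> a
  small perturbation, uniformly in \<open>x\<close> and in the angle.\<close>

lemma chord_dist: "\<bar>chord y x \<theta> - \<bar>x\<bar>\<bar> \<le> \<bar>y\<bar>"
proof -
  have "\<bar>\<bar>x\<bar> - \<bar>y\<bar>\<bar> \<le> chord y x \<theta>"
    unfolding chord_def using real_sqrt_le_mono[OF chord_radicand_ge[of x y \<theta>]] by simp
  moreover have "chord y x \<theta> \<le> \<bar>x\<bar> + \<bar>y\<bar>"
    unfolding chord_def using chord_radicand_le[of x y \<theta>] by (simp add: real_le_lsqrt)
  ultimately show ?thesis by linarith
qed

lemma chord_nonneg: "0 \<le> chord y x \<theta>"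
  unfolding chord_def using chord_radicand_ge[of x y \<theta>]
  by (meson real_sqrt_ge_zero order_trans zero_le_power2)

lemma measurable_chord [measurable]: "(\<lambda>(x, \<theta>). chord y x \<theta>) \<in> borel_measurable (borel \<Otimes>\<^sub>M borel)"
  unfolding chord_def by measurable

lemma measurable_chord_angle [measurable]: "chord y x \<in> borel_measurable borel"
  unfolding chord_def by measurable

section \<open>The angular probability measure\<close>

definition angular_const :: "real \<Rightarrow> real" where
  "angular_const \<nu> = Gamma (\<nu> + 1) / (sqrt pi * Gamma (\<nu> + 1 / 2))"

lemma angular_const_pos: "\<nu> > - 1 / 2 \<Longrightarrow> 0 < angular_const \<nu>"
  unfolding angular_const_def by (intro divide_pos_pos mult_pos_pos Gamma_real_pos) auto

text \<open>The Legendre duplication formula, read as a formula for the Beta function on the diagonal.\<close>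

lemma Beta_diag_real:
  fixes a :: real
  assumes a: "a > 0"
  shows "4 powr (a - 1/2) * Beta a a = sqrt pi * Gamma a / Gamma (a + 1/2)"
proof -
  have n: "complex_of_real t \<notin> \<int>\<^sub>\<le>\<^sub>0" if "t > 0" for t
    using that by (auto elim!: nonpos_Ints_cases simp: complex_eq_iff)
  have "complex_of_real (Gamma a * Gamma (a + 1/2)) =
      complex_of_real (exp ((1 - 2*a) * ln 2) * sqrt pi * Gamma (2*a))"
    using Gamma_legendre_duplication[OF n[OF a], of] n[of "a+1/2"] a
    by (simp add: Gamma_complex_of_real[symmetric] exp_of_real[symmetric])
  hence "Gamma a * Gamma (a + 1/2) = exp ((1 - 2*a) * ln 2) * sqrt pi * Gamma (2*a)"
    by (simp only: of_real_eq_iff)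
  also have "exp ((1 - 2*a) * ln 2) = (2::real) powr (1 - 2*a)" by (simp add: powr_def)
  also have "\<dots> = inverse (4 powr (a - 1/2))"
  proof -
    have "(4::real) powr (a - 1/2) = (2 powr 2) powr (a - 1/2)" by simp
    also have "\<dots> = 2 powr (2 * a - 1)" by (subst powr_powr) (simp add: algebra_simps)
    finally show ?thesis by (simp add: powr_minus[symmetric])
  qed
  finally have *: "4 powr (a - 1/2) * (Gamma a * Gamma (a + 1/2)) = sqrt pi * Gamma (2*a)"
    by (simp add: field_simps)
  have "Gamma a > 0" "Gamma (a + 1/2) > 0" "Gamma (2 * a) > 0" using a by auto
  with * show ?thesis by (simp add: Beta_def field_simps)
qed

lemma power2_powr: "0 < z \<Longrightarrow> (z\<^sup>2) powr a = z powr (2 * a)" for z :: real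
  using powr_powr[of z 2 a] by simp

text \<open>The substitution \<open>t = (1 - cos \<theta>) / 2\<close> gives \<open>4 t (1 - t) = sin\<^sup>2 \<theta>\<close> and turns the left-hand side into
  the Beta integral \<open>4 powr \<nu> * Beta (\<nu> + 1/2) (\<nu> + 1/2)\<close>. Hence the normalising constant of the
  translation makes its angular weight a probability density.\<close>

lemma nn_integral_sin_powr:
  assumes \<nu>: "\<nu> > - 1 / 2"
  shows "(\<integral>\<^sup>+\<theta>. ennreal (sin \<theta> powr (2 * \<nu>)) * indicator {0..pi} \<theta> \<partial>lborel) =
    ennreal (1 / angular_const \<nu>)"
proof -
  define f where "f t = 2 * 4 powr (\<nu> - 1/2) * (t powr (\<nu> - 1/2) * (1 - t) powr (\<nu> - 1/2))" for t :: real
  define g where "g \<theta> = (1 - cos \<theta>) / 2" for \<theta> :: real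
  have "(\<integral>\<^sup>+\<theta>. ennreal (sin \<theta> powr (2 * \<nu>)) * indicator {0..pi} \<theta> \<partial>lborel) =
      (\<integral>\<^sup>+\<theta>. ennreal (f (g \<theta>) * (sin \<theta> / 2) * indicator {0..pi} \<theta>) \<partial>lborel)"
  proof (rule nn_integral_cong)
    fix \<theta> :: real
    have "sin \<theta> powr (2 * \<nu>) = f (g \<theta>) * (sin \<theta> / 2)" if \<theta>: "\<theta> \<in> {0..pi}"
    proof (cases "sin \<theta> = 0")
      case False
      hence s: "sin \<theta> > 0" using \<theta> sin_ge_zero[of \<theta>] by auto
      have c: "0 \<le> g \<theta>" "g \<theta> \<le> 1"
        using cos_ge_minus_one[of \<theta>] by (auto simp: g_def)
      have gg: "4 * (g \<theta> * (1 - g \<theta>)) = (sin \<theta>)\<^sup>2"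
        unfolding g_def sin_squared_eq by (simp add: power2_eq_square field_simps)
      have "f (g \<theta>) = 2 * (4 * (g \<theta> * (1 - g \<theta>))) powr (\<nu> - 1/2)"
        using c by (simp add: f_def powr_mult)
      also have "\<dots> = 2 * sin \<theta> powr (2 * \<nu> - 1)"
        unfolding gg using s by (simp add: power2_powr algebra_simps)
      finally show ?thesis using s by (simp add: powr_diff)
    qed auto
    thus "ennreal (sin \<theta> powr (2 * \<nu>)) * indicator {0..pi} \<theta> =
        ennreal (f (g \<theta>) * (sin \<theta> / 2) * indicator {0..pi} \<theta>)"
      by (cases "\<theta> \<in> {0..pi}", simp_all only: indicator_simps(1) mult_1_right) simp
  qed
  also have "\<dots> = (\<integral>\<^sup>+t. ennreal (f t * indicator {g 0..g pi} t) \<partial>lborel)"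
  proof (rule nn_integral_substitution[symmetric])
    show "set_borel_measurable borel {g 0..g pi} f"
      unfolding set_borel_measurable_def f_def by measurable
    show "(g has_real_derivative sin \<theta> / 2) (at \<theta>)" for \<theta>
      unfolding g_def by (auto intro!: derivative_eq_intros)
  qed (auto intro!: continuous_intros sin_ge_zero)
  also have "\<dots> = (\<integral>\<^sup>+t. ennreal (f t) * indicator {0..1} t \<partial>lborel)"
    by (intro nn_integral_cong) (auto simp: g_def split: split_indicator)
  also have "\<dots> = ennreal (2 * 4 powr (\<nu> - 1/2) * Beta (\<nu> + 1/2) (\<nu> + 1/2))"
  proof (rule nn_integral_has_integral_lebesgue')
    show "(f has_integral 2 * 4 powr (\<nu> - 1/2) * Beta (\<nu> + 1/2) (\<nu> + 1/2)) {0..1}"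
      unfolding f_def using has_integral_mult_right[OF has_integral_Beta_real[of "\<nu>+1/2" "\<nu>+1/2"]] \<nu> by simp
  qed (auto simp: f_def)
  also have "2 * 4 powr (\<nu> - 1/2) = (4::real) powr (\<nu> + 1/2 - 1/2)"
    by (simp add: powr_diff powr_half_sqrt)
  also have "\<dots> * Beta (\<nu> + 1/2) (\<nu> + 1/2) = 1 / angular_const \<nu>"
    using Beta_diag_real[of "\<nu>+1/2"] \<nu> by (simp add: angular_const_def add.commute)
  finally show ?thesis .
qed

definition angular_measure :: "real \<Rightarrow> real measure" where
  "angular_measure \<nu> =
     density lborel (\<lambda>\<theta>. ennreal (angular_const \<nu> * sin \<theta> powr (2 * \<nu>) * indicator {0..pi} \<theta>))"

lemma sets_angular_measure [measurable_cong, simp]: "sets (angular_measure \<nu>) = sets borel"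
  by (simp add: angular_measure_def)

lemma space_angular_measure [simp]: "space (angular_measure \<nu>) = UNIV"
  by (simp add: angular_measure_def)

lemma nn_integral_angular_measure:
  assumes \<nu>: "\<nu> > - 1 / 2" and [measurable]: "h \<in> borel_measurable borel"
  shows "(\<integral>\<^sup>+\<theta>. h \<theta> \<partial>angular_measure \<nu>) = ennreal (angular_const \<nu>) *
     (\<integral>\<^sup>+\<theta>. ennreal (sin \<theta> powr (2 * \<nu>)) * indicator {0..pi} \<theta> * h \<theta> \<partial>lborel)"
  unfolding angular_measure_def using angular_const_pos[OF \<nu>]
  by (subst nn_integral_density, simp, simp, subst nn_integral_cmult[symmetric], simp)
     (auto intro!: nn_integral_cong simp: ennreal_mult ac_simps split: split_indicator)

lemma emeasure_angular_measure_UNIV: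
  assumes \<nu>: "\<nu> > - 1 / 2"
  shows "emeasure (angular_measure \<nu>) UNIV = 1"
proof -
  have "emeasure (angular_measure \<nu>) UNIV = (\<integral>\<^sup>+\<theta>. 1 \<partial>angular_measure \<nu>)" by simp
  also have "\<dots> = 1"
    using nn_integral_angular_measure[OF \<nu>, of "\<lambda>_. 1"] nn_integral_sin_powr[OF \<nu>] angular_const_pos[OF \<nu>]
    by (simp add: ennreal_mult[symmetric] )
  finally show ?thesis .
qed

section \<open>Averaging over the angle preserves integrals\<close>

text \<open>The substitution \<open>t = x\<^sup>2\<close> on each \<open>[0, n]\<close>, followed by monotone convergence as \<open>n\<close> grows.\<close>

lemma nn_integral_square_substitution:
  fixes F :: "real \<Rightarrow> ennreal"
  assumes [measurable]: "F \<in> borel_measurable borel"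
  shows "(\<integral>\<^sup>+x. F (x\<^sup>2) * ennreal (2 * x) * indicator {0..} x \<partial>lborel) =
         (\<integral>\<^sup>+t. F t * indicator {0..} t \<partial>lborel)"
proof -
  have SUP_ind: "(SUP n. c * indicator {0..u n} x) = c * indicator {0..} (x::real)"
    if u: "incseq u" "filterlim u at_top sequentially" for c :: ennreal and u :: "nat \<Rightarrow> real" and x
  proof (rule LIMSEQ_unique[OF LIMSEQ_SUP])
    show "incseq (\<lambda>n. c * indicator {0..u n} x)"
    proof (rule incseq_SucI)
      show "c * indicator {0..u n} x \<le> c * indicator {0..u (Suc n)} x" for n
        using incseq_SucD[OF u(1), of n] by (auto split: split_indicator)
    qed
    have "eventually (\<lambda>n. x \<le> u n) sequentially"
      using u(2) unfolding filterlim_at_top by auto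
    hence "eventually (\<lambda>n. c * indicator {0..u n} x = c * indicator {0..} x) sequentially"
      by eventually_elim (auto split: split_indicator)
    thus "(\<lambda>n. c * indicator {0..u n} x) \<longlonglongrightarrow> c * indicator {0..} x"
      by (rule tendsto_eventually)
  qed
  have mono_ind: "incseq (\<lambda>n x. c x * indicator {0..u n} (x::real))"
    if u: "incseq u" for c :: "real \<Rightarrow> ennreal" and u :: "nat \<Rightarrow> real"
    using incseqD[OF u] by (intro incseq_SucI le_funI) (auto simp: incseq_Suc_iff split: split_indicator intro: order_trans)
  have i1: "incseq real" by (simp add: mono_def)
  have l1: "filterlim real at_top sequentially" by (rule filterlim_real_sequentially)
  have i2: "incseq (\<lambda>n. (real n)\<^sup>2)" by (intro incseq_SucI power_mono) auto
  have l2: "filterlim (\<lambda>n. (real n)\<^sup>2) at_top sequentially"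
    by (rule filterlim_pow_at_top[OF _ l1]) simp
  have sub: "(\<integral>\<^sup>+t. F t * indicator {0..(real n)\<^sup>2} t \<partial>lborel) =
      (\<integral>\<^sup>+x. F (x\<^sup>2) * ennreal (2 * x) * indicator {0..real n} x \<partial>lborel)" for n
  proof (cases "n = 0")
    case True
    have "AE x in lborel. x \<noteq> (0::real)" by (rule AE_lborel_singleton)
    hence "AE x in lborel. F x * indicator {0..(real n)\<^sup>2} x =
        F (x\<^sup>2) * ennreal (2 * x) * indicator {0..real n} x"
      by eventually_elim (auto simp: True split: split_indicator)
    thus ?thesis by (rule nn_integral_cong_AE)
  next
    case False
    have "(\<integral>\<^sup>+t. F t * indicator {0\<^sup>2..(real n)\<^sup>2} t \<partial>lborel) =
      (\<integral>\<^sup>+x. F (x\<^sup>2) * ennreal (2 * x) * indicator {0..real n} x \<partial>lborel)"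
      by (rule nn_integral_substitution_aux)
         (use False in \<open>auto intro!: derivative_eq_intros continuous_intros\<close>)
    thus ?thesis by simp
  qed
  have "(\<integral>\<^sup>+x. F (x\<^sup>2) * ennreal (2 * x) * indicator {0..} x \<partial>lborel) =
      (\<integral>\<^sup>+x. (SUP n. F (x\<^sup>2) * ennreal (2 * x) * indicator {0..real n} x) \<partial>lborel)"
    by (simp add: SUP_ind[OF i1 l1])
  also have "\<dots> = (SUP n. (\<integral>\<^sup>+x. F (x\<^sup>2) * ennreal (2 * x) * indicator {0..real n} x \<partial>lborel))"
    by (rule nn_integral_monotone_convergence_SUP[OF mono_ind[OF i1]]) simp
  also have "\<dots> = (SUP n. (\<integral>\<^sup>+t. F t * indicator {0..(real n)\<^sup>2} t \<partial>lborel))"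
    by (simp add: sub)
  also have "\<dots> = (\<integral>\<^sup>+t. (SUP n. F t * indicator {0..(real n)\<^sup>2} t) \<partial>lborel)"
    by (rule nn_integral_monotone_convergence_SUP[OF mono_ind[OF i2], symmetric]) simp
  also have "\<dots> = (\<integral>\<^sup>+t. F t * indicator {0..} t \<partial>lborel)"
    by (simp add: SUP_ind[OF i2 l2])
  finally show ?thesis .
qed

lemma space_bessel_measure [simp]: "space (bessel_measure \<nu>) = {0..}"
  by (simp add: bessel_measure_def)

lemma sets_bessel_measure [measurable_cong]: "sets (bessel_measure \<nu>) = sets (lebesgue_on {0..})"
  by (simp add: bessel_measure_def)

lemma borel_imp_measurable_bessel:
  "f \<in> borel_measurable borel \<Longrightarrow> f \<in> borel_measurable (bessel_measure \<nu>)"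
  unfolding bessel_measure_def
  by (simp add: measurable_restrict_space1 measurable_completion)

lemma nn_integral_bessel_measure:
  assumes f [measurable]: "f \<in> borel_measurable borel"
  shows "(\<integral>\<^sup>+x. f x \<partial>bessel_measure \<nu>) =
     (\<integral>\<^sup>+x. f x * ennreal (x powr (2 * \<nu> + 1)) * indicator {0..} x \<partial>lborel)"
proof -
  have m: "g \<in> borel_measurable (lebesgue_on {0..})" if "g \<in> borel_measurable borel" for g :: "real \<Rightarrow> ennreal"
    using that by (simp add: measurable_restrict_space1 measurable_completion)
  have "(\<integral>\<^sup>+x. f x \<partial>bessel_measure \<nu>) =
     (\<integral>\<^sup>+x. ennreal (x powr (2 * \<nu> + 1)) * f x \<partial>lebesgue_on {0..})"
    unfolding bessel_measure_def by (rule nn_integral_density; intro m; measurable)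
  also have "\<dots> = (\<integral>\<^sup>+x. ennreal (x powr (2 * \<nu> + 1)) * f x * indicator {0..} x \<partial>lebesgue)"
    by (rule nn_integral_restrict_space) auto
  finally show ?thesis by (simp add: nn_integral_completion ac_simps)
qed

text \<open>The substitution \<open>u = - x cos \<theta>\<close> for fixed \<open>x\<close>, an increasing function on \<open>[0, \<pi>]\<close> with
  \<open>x\<^sup>2 - u\<^sup>2 = (x sin \<theta>)\<^sup>2\<close>. The squared chord becomes affine in \<open>u\<close>.\<close>

lemma nn_integral_angle_chord:
  fixes h :: "real \<Rightarrow> ennreal"
  assumes [measurable]: "h \<in> borel_measurable borel" and x: "x > 0"
  shows "(\<integral>\<^sup>+\<theta>. ennreal (sin \<theta> powr (2 * \<nu>)) * indicator {0..pi} \<theta> * h (chord y x \<theta>) \<partial>lborel)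
      * ennreal (x powr (2 * \<nu> + 1)) =
    (\<integral>\<^sup>+u. h (sqrt (x\<^sup>2 + y\<^sup>2 + 2 * y * u)) * ennreal ((x\<^sup>2 - u\<^sup>2) powr (\<nu> - 1/2) * x)
      * indicator {-x..x} u \<partial>lborel)"
proof -
  define f where "f u = h (sqrt (x\<^sup>2 + y\<^sup>2 + 2 * y * u)) * ennreal ((x\<^sup>2 - u\<^sup>2) powr (\<nu> - 1/2) * x)" for u
  define g where "g \<theta> = - x * cos \<theta>" for \<theta>
  have "(\<integral>\<^sup>+\<theta>. ennreal (sin \<theta> powr (2 * \<nu>)) * indicator {0..pi} \<theta> * h (chord y x \<theta>) \<partial>lborel)
      * ennreal (x powr (2 * \<nu> + 1)) =
    (\<integral>\<^sup>+\<theta>. ennreal (sin \<theta> powr (2 * \<nu>)) * indicator {0..pi} \<theta> * h (chord y x \<theta>)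
      * ennreal (x powr (2 * \<nu> + 1)) \<partial>lborel)"
    by (rule nn_integral_multc[symmetric]) measurable
  also have "\<dots> = (\<integral>\<^sup>+\<theta>. f (g \<theta>) * ennreal (x * sin \<theta>) * indicator {0..pi} \<theta> \<partial>lborel)"
  proof (rule nn_integral_cong)
    fix \<theta> :: real
    have "(x\<^sup>2 - (g \<theta>)\<^sup>2) powr (\<nu> - 1/2) * x * (x * sin \<theta>) = sin \<theta> powr (2 * \<nu>) * x powr (2 * \<nu> + 1)"
      if \<theta>: "\<theta> \<in> {0..pi}"
    proof (cases "sin \<theta> = 0")
      case False
      hence s: "sin \<theta> > 0" using \<theta> sin_ge_zero[of \<theta>] by auto
      have "x\<^sup>2 - (g \<theta>)\<^sup>2 = (x * sin \<theta>)\<^sup>2"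
        by (simp add: g_def power_mult_distrib sin_squared_eq algebra_simps)
      also have "\<dots> powr (\<nu> - 1/2) = (x * sin \<theta>) powr (2 * \<nu> - 1)"
        using s x by (subst power2_powr) (auto simp: algebra_simps)
      also have "\<dots> * x * (x * sin \<theta>) = (x * sin \<theta>) powr (2 * \<nu>) * x"
        using s x by (simp add: powr_diff)
      also have "\<dots> = sin \<theta> powr (2 * \<nu>) * x powr (2 * \<nu> + 1)"
        using s x by (simp add: powr_mult powr_add)
      finally show ?thesis .
    qed auto
    moreover have "sqrt (x\<^sup>2 + y\<^sup>2 + 2 * y * g \<theta>) = chord y x \<theta>"
      by (simp add: chord_def g_def ac_simps)
    ultimately show "ennreal (sin \<theta> powr (2 * \<nu>)) * indicator {0..pi} \<theta> * h (chord y x \<theta>)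
          * ennreal (x powr (2 * \<nu> + 1)) = f (g \<theta>) * ennreal (x * sin \<theta>) * indicator {0..pi} \<theta>"
      using x sin_ge_zero[of \<theta>]
      by (auto simp: f_def ennreal_mult[symmetric] mult.assoc mult.left_commute[of _ "h _"] split: split_indicator)
  qed
  also have "\<dots> = (\<integral>\<^sup>+u. f u * indicator {g 0..g pi} u \<partial>lborel)"
  proof (rule nn_integral_substitution_aux[symmetric])
    show "f \<in> borel_measurable borel" unfolding f_def by measurable
    show "(g has_real_derivative x * sin \<theta>) (at \<theta>)" for \<theta>
      unfolding g_def by (auto intro!: derivative_eq_intros)
  qed (use x in \<open>auto intro!: continuous_intros sin_ge_zero mult_nonneg_nonneg\<close>)
  finally show ?thesis by (simp add: f_def g_def)
qed

text \<open>The integral of \<open>h (sqrt (u\<^sup>2 + v\<^sup>2)) * v powr (2 * \<nu>)\<close> over the half-plane \<open>v > 0\<close>, written in the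
  variables \<open>u\<close> and \<open>s = v\<^sup>2\<close>, for which \<open>v powr (2 * \<nu>) dv = s powr (\<nu> - 1/2) ds / 2\<close>.\<close>

definition half_plane_integral :: "real \<Rightarrow> (real \<Rightarrow> ennreal) \<Rightarrow> ennreal" where
  "half_plane_integral \<nu> h = (\<integral>\<^sup>+u. (\<integral>\<^sup>+s. h (sqrt (s + u\<^sup>2)) * ennreal (s powr (\<nu> - 1/2)) *
      indicator {0..} s * ennreal (1/2) \<partial>lborel) \<partial>lborel)"

text \<open>The pair \<open>(x, \<theta>)\<close> gives polar coordinates of the point \<open>(u, v) = (- x cos \<theta>, x sin \<theta>)\<close> of the upper
  half-plane, and the chord is the distance from this point to \<open>(- y, 0)\<close>. The weight becomes
  \<open>v powr (2 * \<nu>)\<close>, which does not involve \<open>u\<close>, so a shift in \<open>u\<close> removes \<open>y\<close> altogether. The change to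
  polar coordinates is done one variable at a time, with an exchange of integrals in between.\<close>

lemma polar_integral_chord:
  fixes h :: "real \<Rightarrow> ennreal"
  assumes h [measurable]: "h \<in> borel_measurable borel"
  shows "(\<integral>\<^sup>+x. (\<integral>\<^sup>+\<theta>. ennreal (sin \<theta> powr (2 * \<nu>)) * indicator {0..pi} \<theta> * h (chord y x \<theta>) \<partial>lborel)
      * ennreal (x powr (2 * \<nu> + 1)) * indicator {0..} x \<partial>lborel) = half_plane_integral \<nu> h"
    (is "?L = _")
proof -
  define F where "F u t = h (sqrt (t + y\<^sup>2 + 2 * y * u)) * ennreal ((t - u\<^sup>2) powr (\<nu> - 1/2))
      * indicator {u\<^sup>2..} t * ennreal (1/2)" for u t
  define G where "G u = (\<integral>\<^sup>+s. h (sqrt (s + u\<^sup>2)) * ennreal (s powr (\<nu> - 1/2)) *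
      indicator {0..} s * ennreal (1/2) \<partial>lborel)" for u
  have ind: "(\<lambda>(u::real, t). indicator {u\<^sup>2..} t :: ennreal) \<in> borel_measurable (borel \<Otimes>\<^sub>M borel)"
  proof -
    have *: "(\<lambda>(u::real, t). indicator {u\<^sup>2..} t :: ennreal) = (\<lambda>(u, t). if u\<^sup>2 \<le> t then 1 else 0)"
      by (auto simp: fun_eq_iff)
    show ?thesis unfolding * by measurable
  qed
  have F [measurable]: "(\<lambda>(u, t). F u t) \<in> borel_measurable (borel \<Otimes>\<^sub>M borel)"
  proof -
    have "(\<lambda>(u, t). F u t) = (\<lambda>z. h (sqrt (snd z + y\<^sup>2 + 2 * y * fst z)) *
        ennreal ((snd z - (fst z)\<^sup>2) powr (\<nu> - 1/2)) * (case z of (u, t) \<Rightarrow> indicator {u\<^sup>2..} t) * ennreal (1/2))"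
      by (auto simp: F_def fun_eq_iff)
    also have "\<dots> \<in> borel_measurable (borel \<Otimes>\<^sub>M borel)"
      using ind by (intro borel_measurable_times_ennreal) (measurable, auto)
    finally show ?thesis .
  qed
  \<comment> \<open>\<open>F u (x\<^sup>2)\<close> is the integrand in the coordinates \<open>(u, x)\<close>; its constraint \<open>u\<^sup>2 \<le> x\<^sup>2\<close> is \<open>u \<in> {-x..x}\<close>.\<close>
  have "AE x in lborel. x \<noteq> (0::real)" by (rule AE_lborel_singleton)
  hence "?L = (\<integral>\<^sup>+x. (\<integral>\<^sup>+u. F u (x\<^sup>2) * ennreal (2 * x) * indicator {0..} x \<partial>lborel) \<partial>lborel)"
  proof (intro nn_integral_cong_AE, eventually_elim)
    fix x :: real assume x: "x \<noteq> 0"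
    show "(\<integral>\<^sup>+\<theta>. ennreal (sin \<theta> powr (2 * \<nu>)) * indicator {0..pi} \<theta> * h (chord y x \<theta>) \<partial>lborel)
      * ennreal (x powr (2 * \<nu> + 1)) * indicator {0..} x =
      (\<integral>\<^sup>+u. F u (x\<^sup>2) * ennreal (2 * x) * indicator {0..} x \<partial>lborel)"
    proof (cases "x > 0")
      case True
      have half: "ennreal (1/2) * ennreal (2 * x) = ennreal x"
        using True by (subst ennreal_mult[symmetric]) auto
      have "h (sqrt (x\<^sup>2 + y\<^sup>2 + 2 * y * u)) * ennreal ((x\<^sup>2 - u\<^sup>2) powr (\<nu> - 1/2) * x)
          * indicator {-x..x} u = F u (x\<^sup>2) * ennreal (2 * x) * indicator {0..} x" for u
      proof -
        have "u\<^sup>2 \<le> x\<^sup>2 \<longleftrightarrow> u \<in> {-x..x}"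
          using True by (simp add: abs_le_square_iff[symmetric]) auto
        hence ind_eq: "indicator {u\<^sup>2..} (x\<^sup>2) = (indicator {-x..x} u :: ennreal)"
          by (auto split: split_indicator)
        have "F u (x\<^sup>2) * ennreal (2 * x) * indicator {0..} x =
          h (sqrt (x\<^sup>2 + y\<^sup>2 + 2 * y * u)) * ennreal ((x\<^sup>2 - u\<^sup>2) powr (\<nu> - 1/2)) *
          indicator {-x..x} u * (ennreal (1/2) * ennreal (2 * x))"
          using True unfolding F_def ind_eq by (simp add: mult.assoc)
        thus ?thesis using True unfolding half by (simp add: ennreal_mult mult.assoc mult.commute mult.left_commute)
      qed
      thus ?thesis using nn_integral_angle_chord[OF h True, of \<nu> y] True by simp
    qed (use x in auto)
  qed
  also have "\<dots> = (\<integral>\<^sup>+u. (\<integral>\<^sup>+x. F u (x\<^sup>2) * ennreal (2 * x) * indicator {0..} x \<partial>lborel) \<partial>lborel)"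
    by (rule lborel_pair.Fubini') measurable
  also have "\<dots> = (\<integral>\<^sup>+u. G (y + u) \<partial>lborel)"
  proof (rule nn_integral_cong)
    fix u :: real
    have "(\<integral>\<^sup>+x. F u (x\<^sup>2) * ennreal (2 * x) * indicator {0..} x \<partial>lborel) =
        (\<integral>\<^sup>+t. F u t * indicator {0..} t \<partial>lborel)"
      by (rule nn_integral_square_substitution) measurable
    also have "\<dots> = (\<integral>\<^sup>+s. F u (u\<^sup>2 + s) * indicator {0..} (u\<^sup>2 + s) \<partial>lborel)"
      using nn_integral_real_affine[of "\<lambda>t. F u t * indicator {0..} t" 1 "u\<^sup>2"] by simp
    also have "\<dots> = G (y + u)"
      unfolding G_def F_def
    proof (intro nn_integral_cong)
      fix s :: real
      have eq: "u\<^sup>2 + s + y\<^sup>2 + 2 * y * u = s + (y + u)\<^sup>2" by (simp add: power2_sum)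
      show "h (sqrt (u\<^sup>2 + s + y\<^sup>2 + 2 * y * u)) * ennreal ((u\<^sup>2 + s - u\<^sup>2) powr (\<nu> - 1 / 2)) *
         indicator {u\<^sup>2..} (u\<^sup>2 + s) * ennreal (1 / 2) * indicator {0..} (u\<^sup>2 + s) =
         h (sqrt (s + (y + u)\<^sup>2)) * ennreal (s powr (\<nu> - 1 / 2)) * indicator {0..} s * ennreal (1 / 2)"
        unfolding eq by (auto split: split_indicator)
    qed
    finally show "(\<integral>\<^sup>+x. F u (x\<^sup>2) * ennreal (2 * x) * indicator {0..} x \<partial>lborel) = G (y + u)" .
  qed
  also have "\<dots> = (\<integral>\<^sup>+u. G u \<partial>lborel)"
  proof -
    have "G \<in> borel_measurable borel" unfolding G_def by measurable
    thus ?thesis using nn_integral_real_affine[of G 1 y] by simp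
  qed
  finally show ?thesis by (simp add: G_def half_plane_integral_def)
qed

text \<open>By \<open>polar_integral_chord\<close> the left-hand side does not depend on \<open>y\<close>, and for \<open>y = 0\<close> the chord has
  length \<open>x\<close> whatever the angle, so that the average is trivial.\<close>

lemma nn_integral_bessel_average:
  fixes h :: "real \<Rightarrow> ennreal"
  assumes \<nu>: "\<nu> > - 1 / 2" and h [measurable]: "h \<in> borel_measurable borel"
  shows "(\<integral>\<^sup>+x. (\<integral>\<^sup>+\<theta>. h (chord y x \<theta>) \<partial>angular_measure \<nu>) \<partial>bessel_measure \<nu>) =
    (\<integral>\<^sup>+x. h x \<partial>bessel_measure \<nu>)"
proof -
  let ?A = "\<lambda>y x. (\<integral>\<^sup>+\<theta>. ennreal (sin \<theta> powr (2 * \<nu>)) * indicator {0..pi} \<theta> * h (chord y x \<theta>) \<partial>lborel)"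
  have eq: "(\<integral>\<^sup>+x. (\<integral>\<^sup>+\<theta>. h (chord y x \<theta>) \<partial>angular_measure \<nu>) \<partial>bessel_measure \<nu>) =
      ennreal (angular_const \<nu>) * half_plane_integral \<nu> h" for y
  proof -
    have [measurable]: "?A y \<in> borel_measurable borel" by measurable
    have "(\<integral>\<^sup>+x. (\<integral>\<^sup>+\<theta>. h (chord y x \<theta>) \<partial>angular_measure \<nu>) \<partial>bessel_measure \<nu>) =
      (\<integral>\<^sup>+x. ennreal (angular_const \<nu>) * ?A y x \<partial>bessel_measure \<nu>)"
      by (subst nn_integral_angular_measure[OF \<nu>]) auto
    also have "\<dots> = ennreal (angular_const \<nu>) * (\<integral>\<^sup>+x. ?A y x \<partial>bessel_measure \<nu>)"
      by (rule nn_integral_cmult) (rule borel_imp_measurable_bessel, measurable)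
    also have "(\<integral>\<^sup>+x. ?A y x \<partial>bessel_measure \<nu>) = half_plane_integral \<nu> h"
      by (subst nn_integral_bessel_measure) (auto simp: polar_integral_chord)
    finally show ?thesis .
  qed
  have "(\<integral>\<^sup>+x. (\<integral>\<^sup>+\<theta>. h (chord y x \<theta>) \<partial>angular_measure \<nu>) \<partial>bessel_measure \<nu>) =
     (\<integral>\<^sup>+x. (\<integral>\<^sup>+\<theta>. h (chord 0 x \<theta>) \<partial>angular_measure \<nu>) \<partial>bessel_measure \<nu>)"
    by (simp add: eq)
  also have "\<dots> = (\<integral>\<^sup>+x. h x \<partial>bessel_measure \<nu>)"
    by (intro nn_integral_cong) (simp add: chord_def emeasure_angular_measure_UNIV[OF \<nu>])
  finally show ?thesis .
qed

section \<open>The translation as an angular average\<close>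

lemma AE_bessel_measure_iff:
  "(AE x in bessel_measure \<nu>. P x) \<longleftrightarrow> (AE x in lborel. 0 \<le> x \<longrightarrow> P x)"
proof
  show "AE x in bessel_measure \<nu>. P x" if "AE x in lborel. 0 \<le> x \<longrightarrow> P x"
  proof -
    have "AE x in lebesgue_on {0..}. P x"
      using AE_completion[OF that] by (subst AE_restrict_space_iff) auto
    thus ?thesis unfolding bessel_measure_def
      by (subst AE_density)
         (auto intro!: measurable_restrict_space1 measurable_completion)
  qed
  assume "AE x in bessel_measure \<nu>. P x"
  hence "AE x in lebesgue_on {0..}. 0 < ennreal (x powr (2 * \<nu> + 1)) \<longrightarrow> P x"
    unfolding bessel_measure_def
    by (subst (asm) AE_density) (auto intro!: measurable_restrict_space1 measurable_completion)
  hence "AE x in lborel. x \<in> {0..} \<longrightarrow> 0 < ennreal (x powr (2 * \<nu> + 1)) \<longrightarrow> P x"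
    by (subst (asm) AE_restrict_space_iff) (auto simp: AE_completion_iff)
  with AE_lborel_singleton[of "0::real"] show "AE x in lborel. 0 \<le> x \<longrightarrow> P x"
    by eventually_elim auto
qed

text \<open>Members of the Lebesgue spaces are only Lebesgue measurable, and composing such a function with the
  chord need not give a measurable function. Arguments about integrals over the angle are therefore
  carried out for a Borel representative.\<close>

lemma bessel_borel_representative:
  fixes f :: "real \<Rightarrow> complex"
  assumes "f \<in> borel_measurable (bessel_measure \<nu>)"
  obtains f' where "f' \<in> borel_measurable borel" "AE x in bessel_measure \<nu>. f x = f' x"
proof -
  define F where "F x = (if x \<in> {0..} then f x else 0)" for x
  have "f \<in> borel_measurable (lebesgue_on {0..})"
    using assms by (simp cong: measurable_cong_sets add: bessel_measure_def)
  hence [measurable]: "F \<in> borel_measurable lebesgue"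
    unfolding F_def by (rule borel_measurable_if_I) auto
  have "(\<lambda>x. Re (F x)) \<in> borel_measurable lebesgue" "(\<lambda>x. Im (F x)) \<in> borel_measurable lebesgue"
    by measurable
  then obtain u v where [measurable]: "u \<in> borel_measurable lborel" "v \<in> borel_measurable lborel"
    and ae: "AE x in lborel. Re (F x) = u x" "AE x in lborel. Im (F x) = v x"
    using completion_ex_borel_measurable_real by metis
  show thesis
  proof
    show "(\<lambda>x. Complex (u x) (v x)) \<in> borel_measurable borel"
      unfolding Complex_eq by measurable
    show "AE x in bessel_measure \<nu>. f x = Complex (u x) (v x)"
      unfolding AE_bessel_measure_iff using ae
      by eventually_elim (auto simp: F_def complex_eq_iff)
  qed
qed

lemma borel_measurable_bessel_AE:
  fixes f f' :: "real \<Rightarrow> complex"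
  assumes f': "f' \<in> borel_measurable borel" and ae: "AE x in bessel_measure \<nu>. f x = f' x"
  shows "f \<in> borel_measurable (bessel_measure \<nu>)"
proof -
  have "(\<lambda>x. if x \<in> {0..} then f' x else 0) \<in> borel_measurable lebesgue"
    using f' by (intro measurable_completion) simp
  moreover have "AE x in lebesgue. (if x \<in> {0..} then f' x else 0) = (if x \<in> {0..} then f x else 0)"
    using ae unfolding AE_bessel_measure_iff AE_completion_iff by eventually_elim auto
  ultimately have "(\<lambda>x. if x \<in> {0..} then f x else 0) \<in> borel_measurable lebesgue"
    by (rule borel_measurable_AE)
  hence "f \<in> borel_measurable (lebesgue_on {0..})"
    by (rule borel_measurable_if_D)
  thus ?thesis by (simp cong: measurable_cong_sets add: bessel_measure_def)
qed

definition angular_average :: "real \<Rightarrow> real \<Rightarrow> (real \<Rightarrow> complex) \<Rightarrow> real \<Rightarrow> complex" where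
  "angular_average \<nu> y f x = (\<integral>\<theta>. f (chord y x \<theta>) \<partial>angular_measure \<nu>)"

lemma bessel_translation_eq_average:
  assumes \<nu>: "\<nu> > - 1 / 2" and [measurable]: "f \<in> borel_measurable borel"
  shows "bessel_translation \<nu> y f x = angular_average \<nu> y f x"
proof -
  have "(LINT \<theta>:{0..pi}|lebesgue. f (chord y x \<theta>) * complex_of_real (sin \<theta> powr (2 * \<nu>))) =
     (\<integral>\<theta>. indicator {0..pi} \<theta> *\<^sub>R (f (chord y x \<theta>) * complex_of_real (sin \<theta> powr (2 * \<nu>))) \<partial>lborel)"
    unfolding set_lebesgue_integral_def by (rule integral_completion) measurable
  hence "bessel_translation \<nu> y f x = (\<integral>\<theta>. complex_of_real (angular_const \<nu>) *
     (indicator {0..pi} \<theta> *\<^sub>R (f (chord y x \<theta>) * complex_of_real (sin \<theta> powr (2 * \<nu>)))) \<partial>lborel)"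
    unfolding bessel_translation_def chord_def angular_const_def
    by (simp only: integral_mult_right_zero)
  also have "\<dots> = (\<integral>\<theta>. (angular_const \<nu> * sin \<theta> powr (2 * \<nu>) * indicator {0..pi} \<theta>) *\<^sub>R f (chord y x \<theta>) \<partial>lborel)"
    by (intro Bochner_Integration.integral_cong) (auto simp: scaleR_conv_of_real ac_simps)
  also have "\<dots> = angular_average \<nu> y f x"
    unfolding angular_average_def angular_measure_def
    by (rule integral_density[symmetric]) (use angular_const_pos[OF \<nu>] in auto)
  finally show ?thesis .
qed

text \<open>Apply the preservation of integrals to the indicator function of a Borel null set: for almost
  every \<open>x\<close> the chord avoids that set for almost every angle.\<close>

lemma AE_bessel_chord:
  assumes \<nu>: "\<nu> > - 1 / 2" and ae: "AE x in bessel_measure \<nu>. P x"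
  shows "AE x in bessel_measure \<nu>. AE \<theta> in angular_measure \<nu>. P (chord y x \<theta>)"
proof -
  have "AE x in lborel. 0 \<le> x \<longrightarrow> P x" using ae by (simp add: AE_bessel_measure_iff)
  then obtain N where N: "N \<in> null_sets lborel" "{x. \<not> (0 \<le> x \<longrightarrow> P x)} \<subseteq> N"
    unfolding eventually_ae_filter by auto
  have [measurable]: "N \<in> sets borel" using N(1) by auto
  have "(\<integral>\<^sup>+x. indicator N x \<partial>bessel_measure \<nu>) = 0"
  proof -
    have "AE x in lborel. x \<notin> N" by (rule AE_not_in[OF N(1)])
    hence "AE x in bessel_measure \<nu>. indicator N x = (0::ennreal)"
      unfolding AE_bessel_measure_iff by eventually_elim auto
    thus ?thesis by (simp cong: nn_integral_cong_AE)
  qed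
  hence "(\<integral>\<^sup>+x. (\<integral>\<^sup>+\<theta>. indicator N (chord y x \<theta>) \<partial>angular_measure \<nu>) \<partial>bessel_measure \<nu>) = 0"
    by (subst nn_integral_bessel_average[OF \<nu>]) auto
  moreover have "(\<lambda>x. (\<integral>\<^sup>+\<theta>. indicator N (chord y x \<theta>) \<partial>angular_measure \<nu>)) \<in> borel_measurable borel"
    by (subst nn_integral_angular_measure[OF \<nu>]) measurable
  ultimately have "AE x in bessel_measure \<nu>. (\<integral>\<^sup>+\<theta>. indicator N (chord y x \<theta>) \<partial>angular_measure \<nu>) = 0"
    by (subst (asm) nn_integral_0_iff_AE) (auto intro: borel_imp_measurable_bessel)
  thus ?thesis
  proof eventually_elim
    fix x assume "(\<integral>\<^sup>+\<theta>. indicator N (chord y x \<theta>) \<partial>angular_measure \<nu>) = 0"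
    hence "AE \<theta> in angular_measure \<nu>. indicator N (chord y x \<theta>) = (0::ennreal)"
      by (subst (asm) nn_integral_0_iff_AE) auto
    thus "AE \<theta> in angular_measure \<nu>. P (chord y x \<theta>)"
    proof eventually_elim
      fix \<theta> assume "indicator N (chord y x \<theta>) = (0::ennreal)"
      thus "P (chord y x \<theta>)" using N(2) chord_nonneg[of y x \<theta>] by (auto split: split_indicator_asm)
    qed
  qed
qed

text \<open>Passing to a Borel representative changes the translate on a null set only. Where \<open>sin \<theta> = 0\<close> the
  angular density gives no information about \<open>f\<close>, but there the integrand is \<open>0\<close> by the convention
  \<open>0 powr a = 0\<close>.\<close>

lemma bessel_translation_cong_AE:
  assumes \<nu>: "\<nu> > - 1 / 2" and [measurable]: "f' \<in> borel_measurable borel"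
    and ae: "AE x in bessel_measure \<nu>. f x = f' x"
  shows "AE x in bessel_measure \<nu>. bessel_translation \<nu> y f x = angular_average \<nu> y f' x"
  using AE_bessel_chord[OF \<nu> ae, of y]
proof eventually_elim
  fix x
  let ?g = "\<lambda>f \<theta>. indicator {0..pi} \<theta> *\<^sub>R (f (chord y x \<theta>) * complex_of_real (sin \<theta> powr (2 * \<nu>)))"
  assume "AE \<theta> in angular_measure \<nu>. f (chord y x \<theta>) = f' (chord y x \<theta>)"
  hence "AE \<theta> in lborel. 0 < angular_const \<nu> * sin \<theta> powr (2 * \<nu>) * indicator {0..pi} \<theta> \<longrightarrow>
      f (chord y x \<theta>) = f' (chord y x \<theta>)"
    unfolding angular_measure_def by (subst (asm) AE_density) auto
  hence "AE \<theta> in lborel. ?g f' \<theta> = ?g f \<theta>"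
  proof eventually_elim
    fix \<theta> assume *: "0 < angular_const \<nu> * sin \<theta> powr (2 * \<nu>) * indicator {0..pi} \<theta> \<longrightarrow>
      f (chord y x \<theta>) = f' (chord y x \<theta>)"
    show "?g f' \<theta> = ?g f \<theta>"
      using * angular_const_pos[OF \<nu>] by (cases "sin \<theta> = 0") (auto split: split_indicator)
  qed
  hence ae': "AE \<theta> in lebesgue. ?g f' \<theta> = ?g f \<theta>" by (simp only: AE_completion_iff)
  have m: "?g f' \<in> borel_measurable lebesgue" by (intro measurable_completion) measurable
  have "integral\<^sup>L lebesgue (?g f) = integral\<^sup>L lebesgue (?g f')"
    by (rule integral_cong_AE[OF m borel_measurable_AE[OF m ae'] ae', symmetric])
  hence "bessel_translation \<nu> y f x = bessel_translation \<nu> y f' x"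
    unfolding bessel_translation_def set_lebesgue_integral_def chord_def by simp
  thus "bessel_translation \<nu> y f x = angular_average \<nu> y f' x"
    by (simp add: bessel_translation_eq_average[OF \<nu>])
qed

section \<open>Jensen's inequality for powers\<close>

text \<open>Convexity of \<open>t powr p\<close> in tangent-line form, a case of weighted arithmetic-geometric means. The
  endpoint \<open>t = 0\<close> is included, as is needed for the norm of a function that may vanish.\<close>

lemma powr_above_tangent:
  fixes t s p :: real
  assumes p: "p \<ge> 1" and t: "t \<ge> 0" and s: "s > 0"
  shows "s powr p + p * s powr (p - 1) * (t - s) \<le> t powr p"
proof -
  have sp: "s powr (p - 1) * s = s powr p" using s by (simp add: powr_diff)
  have "p * s powr (p - 1) * t \<le> t powr p + (p - 1) * s powr p"
  proof (cases "t = 0")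
    case False
    hence t: "t > 0" using t by simp
    have "(t powr p) powr (1/p) * (s powr p) powr (1 - 1/p) \<le> (1/p) * t powr p + (1 - 1/p) * s powr p"
      by (rule Youngs_inequality_0) (use p s t in auto)
    also have "(t powr p) powr (1/p) = t" using p t by (simp add: powr_powr)
    also have "(s powr p) powr (1 - 1/p) = s powr (p - 1)"
      unfolding powr_powr using p by (simp add: right_diff_distrib)
    finally show ?thesis using p by (simp add: field_simps)
  qed (use p in simp)
  thus ?thesis using sp by (simp add: algebra_simps) 
qed

lemma le_one_plus_powr: "p \<ge> 1 \<Longrightarrow> 0 \<le> t \<Longrightarrow> t \<le> 1 + t powr p" for t p :: real
  using powr_mono[of 1 p t] powr_ge_zero[of t p] by (smt (verit) powr_one)

lemma integrable_of_powr_integral_finite: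
  fixes f :: "'a \<Rightarrow> complex"
  assumes M: "emeasure M (space M) = 1" and f [measurable]: "f \<in> borel_measurable M" and p: "p \<ge> 1"
    and fin: "(\<integral>\<^sup>+x. ennreal (norm (f x) powr p) \<partial>M) < \<infinity>"
  shows "integrable M (\<lambda>x. norm (f x) powr p)" "integrable M f"
proof -
  interpret finite_measure M by (rule finite_measureI) (simp add: M)
  show i: "integrable M (\<lambda>x. norm (f x) powr p)"
    using fin by (auto simp: integrable_iff_bounded)
  have "integrable M (\<lambda>x. 1 + norm (f x) powr p)" using i by auto
  thus "integrable M f"
    by (rule Bochner_Integration.integrable_bound) (use le_one_plus_powr[OF p] in auto)
qed

text \<open>Integrate the tangent-line inequality at \<open>s\<close>, the mean of \<open>norm (f x)\<close>: the linear term has integral \<open>0\<close>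
  because \<open>M\<close> has total mass \<open>1\<close>.\<close>

lemma norm_integral_powr_le:
  fixes f :: "'a \<Rightarrow> complex"
  assumes M: "emeasure M (space M) = 1" and f [measurable]: "f \<in> borel_measurable M" and p: "p \<ge> 1"
  shows "ennreal (norm (\<integral>x. f x \<partial>M) powr p) \<le> (\<integral>\<^sup>+x. ennreal (norm (f x) powr p) \<partial>M)"
proof (cases "(\<integral>\<^sup>+x. ennreal (norm (f x) powr p) \<partial>M) < \<infinity>")
  case True
  interpret finite_measure M by (rule finite_measureI) (simp add: M)
  have one: "measure M (space M) = 1" by (simp add: measure_def M)
  note int = integrable_of_powr_integral_finite[OF M f p True]
  define s where "s = (\<integral>x. norm (f x) \<partial>M)"
  have s: "norm (\<integral>x. f x \<partial>M) \<le> s" unfolding s_def by (rule integral_norm_bound)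
  have "s powr p \<le> (\<integral>x. norm (f x) powr p \<partial>M)"
  proof (cases "s > 0")
    case True
    have "s powr p = (\<integral>x. s powr p + p * s powr (p - 1) * (norm (f x) - s) \<partial>M)"
      using int(2) by (simp add: one s_def[symmetric] integrable_norm)
    also have "\<dots> \<le> (\<integral>x. norm (f x) powr p \<partial>M)"
      using int by (intro integral_mono powr_above_tangent[OF p _ True])
        (auto intro!: Bochner_Integration.integrable_add integrable_mult_right Bochner_Integration.integrable_diff)
    finally show ?thesis .
  next
    case False
    hence "s = 0" using s norm_ge_zero[of "\<integral>x. f x \<partial>M"] by linarith
    thus ?thesis by (simp add: integral_nonneg_AE)
  qed
  hence "norm (\<integral>x. f x \<partial>M) powr p \<le> (\<integral>x. norm (f x) powr p \<partial>M)"
    using powr_mono2[OF _ _ s, of p] p by simp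
  thus ?thesis using int(1) by (subst nn_integral_eq_integral) auto
qed (auto simp: not_less top_unique)

section \<open>The translation is a contraction\<close>

lemma angular_average_measurable:
  assumes \<nu>: "\<nu> > - 1 / 2" and [measurable]: "f \<in> borel_measurable borel"
  shows "angular_average \<nu> y f \<in> borel_measurable borel"
proof -
  interpret finite_measure "angular_measure \<nu>"
    by (rule finite_measureI) (simp add: emeasure_angular_measure_UNIV[OF \<nu>])
  show ?thesis unfolding angular_average_def by measurable
qed

text \<open>The \<open>p\<close>-th power of the norm, with values in \<open>[0, \<infinity>]\<close>, so that finiteness is part of its value and
  the rules for nonnegative integrals apply. The inequality \<open>Lp_energy_add\<close> below takes the place of
  the triangle inequality of the norm in all limit arguments.\<close>

definition Lp_energy :: "real \<Rightarrow> real \<Rightarrow> (real \<Rightarrow> complex) \<Rightarrow> ennreal" where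
  "Lp_energy p \<nu> f = (\<integral>\<^sup>+x. ennreal (norm (f x) powr p) \<partial>bessel_measure \<nu>)"

lemma Lp_energy_cong_AE:
  "AE x in bessel_measure \<nu>. f x = g x \<Longrightarrow> Lp_energy p \<nu> f = Lp_energy p \<nu> g"
  unfolding Lp_energy_def by (rule nn_integral_cong_AE) auto

lemma norm_add_powr_le:
  fixes a b :: "'a :: real_normed_vector"
  assumes p: "p \<ge> 0"
  shows "norm (a + b) powr p \<le> 2 powr p * (norm a powr p + norm b powr p)"
proof -
  have "norm (a + b) \<le> 2 * max (norm a) (norm b)" using norm_triangle_ineq[of a b] by linarith
  hence "norm (a + b) powr p \<le> (2 * max (norm a) (norm b)) powr p"
    using p by (intro powr_mono2) auto
  also have "\<dots> = 2 powr p * max (norm a) (norm b) powr p" by (simp add: powr_mult)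
  also have "\<dots> \<le> 2 powr p * (norm a powr p + norm b powr p)"
    by (intro mult_left_mono) (auto simp: max_def)
  finally show ?thesis .
qed

lemma Lp_energy_add:
  assumes p: "p \<ge> 1" and [measurable]: "f \<in> borel_measurable (bessel_measure \<nu>)" "g \<in> borel_measurable (bessel_measure \<nu>)"
  shows "Lp_energy p \<nu> (\<lambda>x. f x + g x) \<le> ennreal (2 powr p) * (Lp_energy p \<nu> f + Lp_energy p \<nu> g)"
proof -
  have "Lp_energy p \<nu> (\<lambda>x. f x + g x) \<le>
      (\<integral>\<^sup>+x. ennreal (2 powr p) * (ennreal (norm (f x) powr p) + ennreal (norm (g x) powr p)) \<partial>bessel_measure \<nu>)"
    unfolding Lp_energy_def using p
    by (intro nn_integral_mono)
       (simp add: ennreal_mult[symmetric] ennreal_plus[symmetric] norm_add_powr_le del: ennreal_plus)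
  also have "\<dots> = ennreal (2 powr p) * (Lp_energy p \<nu> f + Lp_energy p \<nu> g)"
    unfolding Lp_energy_def by (simp add: nn_integral_cmult nn_integral_add)
  finally show ?thesis .
qed

text \<open>Jensen's inequality in the angle, then the preservation of integrals in \<open>x\<close>.\<close>

lemma Lp_energy_average_le:
  assumes \<nu>: "\<nu> > - 1 / 2" and p: "p \<ge> 1" and [measurable]: "f \<in> borel_measurable borel"
  shows "Lp_energy p \<nu> (angular_average \<nu> y f) \<le> Lp_energy p \<nu> f"
proof -
  have "Lp_energy p \<nu> (angular_average \<nu> y f) \<le>
      (\<integral>\<^sup>+x. (\<integral>\<^sup>+\<theta>. ennreal (norm (f (chord y x \<theta>)) powr p) \<partial>angular_measure \<nu>) \<partial>bessel_measure \<nu>)"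
    unfolding Lp_energy_def angular_average_def
    by (intro nn_integral_mono norm_integral_powr_le p) (auto simp: emeasure_angular_measure_UNIV[OF \<nu>])
  also have "\<dots> = Lp_energy p \<nu> f"
    unfolding Lp_energy_def
    using nn_integral_bessel_average[OF \<nu>, of "\<lambda>s. ennreal (norm (f s) powr p)"] by simp
  finally show ?thesis .
qed

lemma AE_integrable_chord:
  assumes \<nu>: "\<nu> > - 1 / 2" and p: "p \<ge> 1" and f [measurable]: "f \<in> borel_measurable borel"
    and fin: "Lp_energy p \<nu> f < \<infinity>"
  shows "AE x in bessel_measure \<nu>. integrable (angular_measure \<nu>) (\<lambda>\<theta>. f (chord y x \<theta>))"
proof -
  let ?I = "\<lambda>x. \<integral>\<^sup>+\<theta>. ennreal (norm (f (chord y x \<theta>)) powr p) \<partial>angular_measure \<nu>"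
  have "?I \<in> borel_measurable borel"
    by (subst nn_integral_angular_measure[OF \<nu>]) measurable
  moreover have "(\<integral>\<^sup>+x. ?I x \<partial>bessel_measure \<nu>) < \<infinity>"
    using nn_integral_bessel_average[OF \<nu>, of "\<lambda>s. ennreal (norm (f s) powr p)"] fin
    by (simp add: Lp_energy_def)
  ultimately have "AE x in bessel_measure \<nu>. ?I x \<noteq> \<infinity>"
    by (intro nn_integral_PInf_AE borel_imp_measurable_bessel) auto
  thus ?thesis
  proof eventually_elim
    fix x assume "?I x \<noteq> \<infinity>"
    thus "integrable (angular_measure \<nu>) (\<lambda>\<theta>. f (chord y x \<theta>))"
      using p by (intro integrable_of_powr_integral_finite(2)[where p = p])
        (auto simp: emeasure_angular_measure_UNIV[OF \<nu>] less_top)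
  qed
qed

section \<open>Small translations of continuous functions\<close>

lemma uniformly_continuous_vanishing_at_infinity:
  fixes g :: "real \<Rightarrow> complex"
  assumes cont: "continuous_on UNIV g" and lim: "(g \<longlongrightarrow> 0) at_infinity"
  shows "uniformly_continuous_on UNIV g"
  unfolding uniformly_continuous_on_def
proof (intro allI impI)
  fix e :: real assume e: "e > 0"
  have "eventually (\<lambda>x. dist (g x) 0 < e / 2) at_infinity"
    using lim e by (intro tendstoD) auto
  then obtain R where R: "\<And>x. R \<le> norm x \<Longrightarrow> norm (g x) < e / 2"
    by (auto simp: eventually_at_infinity)
  have "uniformly_continuous_on (cball 0 (R + 1)) g"
    by (rule compact_uniformly_continuous[OF continuous_on_subset[OF cont]]) auto
  then obtain d where d: "d > 0"
    "\<And>x x'. x \<in> cball 0 (R + 1) \<Longrightarrow> x' \<in> cball 0 (R + 1) \<Longrightarrow> dist x' x < d \<Longrightarrow> dist (g x') (g x) < e"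
    unfolding uniformly_continuous_on_def using e by metis
  show "\<exists>d>0. \<forall>x\<in>UNIV. \<forall>x'\<in>UNIV. dist x' x < d \<longrightarrow> dist (g x') (g x) < e"
  proof (intro exI[of _ "min d 1"] conjI ballI impI)
    fix x x' :: real assume dd: "dist x' x < min d 1"
    show "dist (g x') (g x) < e"
    proof (cases "R \<le> norm x \<and> R \<le> norm x'")
      case True
      thus ?thesis using R[of x] R[of x'] norm_triangle_ineq4[of "g x'" "g x"] by (simp add: dist_norm)
    next
      case False
      hence "x \<in> cball 0 (R + 1)" "x' \<in> cball 0 (R + 1)" using dd by (auto simp: dist_real_def)
      thus ?thesis using d dd by auto
    qed
  qed (use d in auto)
qed

text \<open>The chord differs from \<open>\<bar>x\<bar>\<close> by at most \<open>\<bar>y\<bar>\<close>, so the average runs over values of \<open>g\<close> close to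
  \<open>g \<bar>x\<bar>\<close>.\<close>

lemma angular_average_uniform:
  assumes \<nu>: "\<nu> > - 1 / 2" and g: "uniformly_continuous_on UNIV g" and e: "e > 0"
  shows "\<exists>\<delta>>0. \<forall>y x. \<bar>y\<bar> < \<delta> \<longrightarrow> norm (angular_average \<nu> y g x - g \<bar>x\<bar>) \<le> e"
proof -
  interpret finite_measure "angular_measure \<nu>"
    by (rule finite_measureI) (simp add: emeasure_angular_measure_UNIV[OF \<nu>])
  have one: "measure (angular_measure \<nu>) UNIV = 1"
    by (simp add: measure_def emeasure_angular_measure_UNIV[OF \<nu>])
  have [measurable]: "g \<in> borel_measurable borel"
    using uniformly_continuous_imp_continuous[OF g] by (rule borel_measurable_continuous_onI)
  from g e obtain \<delta> where \<delta>: "\<delta> > 0" "\<And>s t. dist s t < \<delta> \<Longrightarrow> dist (g s) (g t) < e"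
    unfolding uniformly_continuous_on_def by auto
  show ?thesis
  proof (intro exI[of _ \<delta>] conjI allI impI)
    fix y x :: real assume y: "\<bar>y\<bar> < \<delta>"
    have bd: "norm (g (chord y x \<theta>) - g \<bar>x\<bar>) \<le> e" for \<theta>
      using \<delta>(2)[of "chord y x \<theta>" "\<bar>x\<bar>"] chord_dist[of y x \<theta>] y by (simp add: dist_norm)
    have int: "integrable (angular_measure \<nu>) (\<lambda>\<theta>. g (chord y x \<theta>) - g \<bar>x\<bar>)"
      by (rule integrable_const_bound[of _ e]) (auto simp: bd)
    have "integrable (angular_measure \<nu>) (\<lambda>\<theta>. (g (chord y x \<theta>) - g \<bar>x\<bar>) + g \<bar>x\<bar>)"
      by (rule Bochner_Integration.integrable_add[OF int]) simp
    hence "angular_average \<nu> y g x - g \<bar>x\<bar> = (\<integral>\<theta>. g (chord y x \<theta>) - g \<bar>x\<bar> \<partial>angular_measure \<nu>)"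
      by (simp add: angular_average_def one)
    also have "norm \<dots> \<le> (\<integral>\<theta>. norm (g (chord y x \<theta>) - g \<bar>x\<bar>) \<partial>angular_measure \<nu>)"
      by (rule integral_norm_bound)
    also have "\<dots> \<le> (\<integral>\<theta>. e \<partial>angular_measure \<nu>)"
      using int by (intro integral_mono) (auto simp: bd)
    finally show "norm (angular_average \<nu> y g x - g \<bar>x\<bar>) \<le> e" by (simp add: one)
  qed (use \<delta> in auto)
qed

lemma emeasure_bessel_Icc_finite:
  assumes \<nu>: "\<nu> > - 1 / 2" and R: "R \<ge> 0"
  shows "(\<integral>\<^sup>+x. indicator {-R..R} x \<partial>bessel_measure \<nu>) < \<infinity>"
proof -
  have "(\<integral>\<^sup>+x. indicator {-R..R} x \<partial>bessel_measure \<nu>) \<le>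
      (\<integral>\<^sup>+x. ennreal (R powr (2 * \<nu> + 1)) * indicator {0..R} x \<partial>lborel)"
    using \<nu> by (subst nn_integral_bessel_measure)
      (auto intro!: nn_integral_mono ennreal_leI powr_mono2 split: split_indicator)
  also have "\<dots> = ennreal (R powr (2 * \<nu> + 1)) * ennreal R"
    using R by (simp add: nn_integral_cmult)
  also have "\<dots> < \<infinity>" by (simp add: ennreal_mult_less_top)
  finally show ?thesis .
qed

text \<open>For \<open>\<bar>y\<bar> < 1\<close> the translate is supported in \<open>[0, R + 1]\<close>, a set of finite measure, and the difference
  is uniformly small there.\<close>

lemma Lp_energy_average_compact_support:
  assumes \<nu>: "\<nu> > - 1 / 2" and p: "p \<ge> 1" and g: "continuous_on UNIV g"
    and supp: "\<And>x. \<bar>x\<bar> > R \<Longrightarrow> g x = 0" and R: "R \<ge> 0" and e: "e > (0::real)"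
  shows "eventually (\<lambda>y. Lp_energy p \<nu> (\<lambda>x. angular_average \<nu> y g x - g x) \<le> ennreal e) (at 0)"
proof -
  have "(g \<longlongrightarrow> 0) at_infinity"
  proof (rule tendsto_eventually)
    show "eventually (\<lambda>x. g x = 0) at_infinity"
      unfolding eventually_at_infinity by (intro exI[of _ "R + 1"]) (auto intro!: supp)
  qed
  from uniformly_continuous_vanishing_at_infinity[OF g this]
  have unif: "uniformly_continuous_on UNIV g" .
  define K where "K = enn2real (\<integral>\<^sup>+x. indicator {-(R+1)..R+1} x \<partial>bessel_measure \<nu>)"
  have K: "(\<integral>\<^sup>+x. indicator {-(R+1)..R+1} x \<partial>bessel_measure \<nu>) = ennreal K" "K \<ge> 0"
    using emeasure_bessel_Icc_finite[OF \<nu>, of "R+1"] R by (auto simp: K_def less_top)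
  \<comment> \<open>A uniform error \<open>d\<close> on a set of measure \<open>K\<close> costs \<open>d powr p * K\<close>.\<close>
  define d where "d = (e / (K + 1)) powr (1/p)"
  have d: "d > 0" using e K by (simp add: d_def)
  have dp: "d powr p * K \<le> e"
  proof -
    have "d powr p = e / (K + 1)" using e K p by (simp add: d_def powr_powr)
    hence "d powr p * (K + 1) = e" using K by simp
    thus ?thesis by (simp add: distrib_left) (smt (verit) powr_ge_zero)
  qed
  from angular_average_uniform[OF \<nu> unif d] obtain \<delta> where \<delta>: "\<delta> > 0"
    "\<And>y x. \<bar>y\<bar> < \<delta> \<Longrightarrow> norm (angular_average \<nu> y g x - g \<bar>x\<bar>) \<le> d" by auto
  have "eventually (\<lambda>y. dist y 0 < min \<delta> 1) (at (0::real))"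
    unfolding eventually_at using \<delta>(1) by (intro exI[of _ "min \<delta> 1"]) auto
  thus ?thesis
  proof eventually_elim
    fix y :: real assume y: "dist y 0 < min \<delta> 1"
    have "Lp_energy p \<nu> (\<lambda>x. angular_average \<nu> y g x - g x) \<le>
        (\<integral>\<^sup>+x. ennreal (d powr p) * indicator {-(R+1)..R+1} x \<partial>bessel_measure \<nu>)"
      unfolding Lp_energy_def
    proof (rule nn_integral_mono)
      fix x assume "x \<in> space (bessel_measure \<nu>)"
      hence x: "x \<ge> 0" by simp
      show "ennreal (norm (angular_average \<nu> y g x - g x) powr p) \<le>
          ennreal (d powr p) * indicator {-(R+1)..R+1} x"
      proof (cases "x \<le> R + 1")
        case True
        have "norm (angular_average \<nu> y g x - g x) \<le> d" using \<delta>(2)[of y x] y x by simp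
        thus ?thesis using True x R p by (auto intro!: ennreal_leI powr_mono2)
      next
        case False
        have "g (chord y x \<theta>) = 0" for \<theta>
          using chord_dist[of y x \<theta>] y False x by (intro supp) auto
        thus ?thesis using False x supp[of x] by (simp add: angular_average_def)
      qed
    qed
    also have "\<dots> = ennreal (d powr p) * ennreal K"
      unfolding K(1)[symmetric] by (rule nn_integral_cmult) (intro borel_imp_measurable_bessel, measurable)
    also have "\<dots> \<le> ennreal e" using dp K by (simp add: ennreal_mult[symmetric] ennreal_leI)
    finally show "Lp_energy p \<nu> (\<lambda>x. angular_average \<nu> y g x - g x) \<le> ennreal e" .
  qed
qed

section \<open>Density of compactly supported continuous functions\<close>

lemma Lp_truncation:
  assumes p: "p \<ge> 1" and f [measurable]: "f \<in> borel_measurable borel"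
    and fin: "Lp_energy p \<nu> f < \<infinity>" and e: "e > (0::real)"
  obtains B h where "B > 0" "h \<in> borel_measurable borel" "\<And>x. norm (h x) \<le> B" "\<And>x. \<bar>x\<bar> > B \<Longrightarrow> h x = 0"
    "Lp_energy p \<nu> (\<lambda>x. f x - h x) \<le> ennreal e"
proof -
  define h where "h n x = (if norm (f x) \<le> Suc n \<and> \<bar>x\<bar> \<le> Suc n then f x else 0)" for n :: nat and x
  have [measurable]: "h n \<in> borel_measurable borel" for n unfolding h_def by measurable
  have "(\<lambda>n. \<integral>\<^sup>+x. ennreal (norm (f x - h n x) powr p) \<partial>bessel_measure \<nu>) \<longlonglongrightarrow>
      (\<integral>\<^sup>+x. 0 \<partial>bessel_measure \<nu>)"
  proof (rule nn_integral_dominated_convergence[where w = "\<lambda>x. ennreal (norm (f x) powr p)"])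
    show "(\<integral>\<^sup>+x. ennreal (norm (f x) powr p) \<partial>bessel_measure \<nu>) < \<infinity>"
      using fin by (simp add: Lp_energy_def)
    show "AE x in bessel_measure \<nu>. ennreal (norm (f x - h n x) powr p) \<le> ennreal (norm (f x) powr p)" for n
      by (auto simp: h_def)
    show "AE x in bessel_measure \<nu>. (\<lambda>n. ennreal (norm (f x - h n x) powr p)) \<longlonglongrightarrow> 0"
    proof (rule AE_I2, rule tendsto_eventually)
      fix x
      obtain N :: nat where N: "max (norm (f x)) \<bar>x\<bar> \<le> N" using real_arch_simple by blast
      show "eventually (\<lambda>n. ennreal (norm (f x - h n x) powr p) = 0) sequentially"
        using eventually_ge_at_top[of N] by eventually_elim (use N in \<open>auto simp: h_def\<close>)
    qed
  qed (intro borel_imp_measurable_bessel; measurable)+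
  hence "(\<lambda>n. Lp_energy p \<nu> (\<lambda>x. f x - h n x)) \<longlonglongrightarrow> 0" by (simp add: Lp_energy_def)
  from order_tendstoD(2)[OF this, of "ennreal e"] e
  obtain n where n: "Lp_energy p \<nu> (\<lambda>x. f x - h n x) < ennreal e"
    by (auto simp: eventually_sequentially)
  show thesis
    by (rule that[of "real (Suc n)" "h n"]) (use n in \<open>auto simp: h_def\<close>)
qed

text \<open>A measurable function is an almost everywhere limit of continuous functions. Radial truncation of
  their values to norm \<open>B\<close> and multiplication by a continuous cutoff keep the limit and provide a
  dominating function for the convergence of the energies.\<close>

lemma Lp_continuous_approximation_bounded:
  assumes \<nu>: "\<nu> > - 1 / 2" and p: "p \<ge> 1" and B: "B > 0" and h [measurable]: "h \<in> borel_measurable borel"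
    and hB: "\<And>x. norm (h x) \<le> B" and supp: "\<And>x. \<bar>x\<bar> > B \<Longrightarrow> h x = 0" and e: "e > (0::real)"
  obtains g where "continuous_on UNIV g" "\<And>x. \<bar>x\<bar> > B + 1 \<Longrightarrow> g x = 0"
    "Lp_energy p \<nu> (\<lambda>x. h x - g x) \<le> ennreal e"
proof -
  have "h measurable_on UNIV"
    by (rule lebesgue_measurable_imp_measurable_on) (auto intro: measurable_completion)
  then obtain N G where N: "negligible N" and G: "\<And>n. continuous_on UNIV (G n)"
    and lim: "\<And>x. x \<notin> N \<Longrightarrow> (\<lambda>n. G n x) \<longlonglongrightarrow> h x"
    unfolding measurable_on_def by auto
  define c where "c z = (B / max B (norm z)) *\<^sub>R z" for z :: complex
  define \<phi> where "\<phi> x = max 0 (min 1 (B + 1 - \<bar>x\<bar>))" for x :: real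
  define g where "g n x = \<phi> x *\<^sub>R c (G n x)" for n x
  have nz: "max B (norm z) \<noteq> 0" for z :: complex using B by (auto simp: max_def)
  have c_cont: "continuous_on UNIV c"
    unfolding c_def using nz by (intro continuous_intros) auto
  have c_le: "norm (c z) \<le> B" for z
  proof -
    have "norm (c z) = B * (norm z / max B (norm z))" using B by (simp add: c_def)
    also have "\<dots> \<le> B * 1" using B by (intro mult_left_mono) (auto simp: divide_le_eq)
    finally show ?thesis by simp
  qed
  have c_id: "c z = z" if "norm z \<le> B" for z using that B by (simp add: c_def)
  have \<phi>: "0 \<le> \<phi> x" "\<phi> x \<le> 1" for x by (auto simp: \<phi>_def)
  have g_cont: "continuous_on UNIV (g n)" for n
    unfolding g_def \<phi>_def
    by (intro continuous_intros continuous_on_compose2[OF c_cont G]) auto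
  hence [measurable]: "g n \<in> borel_measurable borel" for n
    by (intro borel_measurable_continuous_onI)
  have g_supp: "g n x = 0" if "\<bar>x\<bar> > B + 1" for n x using that by (simp add: g_def \<phi>_def)
  have g_le: "norm (g n x) \<le> B" for n x
    using mult_mono[OF \<phi>(2)[of x] c_le[of "G n x"]] \<phi>(1)[of x] by (simp add: g_def)
  have g_lim: "(\<lambda>n. g n x) \<longlonglongrightarrow> h x" if x: "x \<notin> N" for x
  proof -
    have "isCont c (h x)" using c_cont by (simp add: continuous_on_eq_continuous_at)
    hence "(\<lambda>n. c (G n x)) \<longlonglongrightarrow> c (h x)" using lim[OF x] by (rule isCont_tendsto_compose)
    hence "(\<lambda>n. g n x) \<longlonglongrightarrow> \<phi> x *\<^sub>R c (h x)" unfolding g_def by (intro tendsto_intros)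
    also have "c (h x) = h x" by (rule c_id[OF hB])
    also have "\<phi> x *\<^sub>R h x = h x" using supp[of x] by (cases "\<bar>x\<bar> \<le> B") (auto simp: \<phi>_def)
    finally show ?thesis .
  qed
  have "AE x in lebesgue. x \<notin> N"
    using N by (intro AE_not_in) (simp add: negligible_iff_null_sets)
  hence ae: "AE x in bessel_measure \<nu>. x \<notin> N"
    unfolding AE_completion_iff AE_bessel_measure_iff by eventually_elim auto
  have "(\<lambda>n. \<integral>\<^sup>+x. ennreal (norm (h x - g n x) powr p) \<partial>bessel_measure \<nu>) \<longlonglongrightarrow>
      (\<integral>\<^sup>+x. 0 \<partial>bessel_measure \<nu>)"
  proof (rule nn_integral_dominated_convergence[where
      w = "\<lambda>x. ennreal ((2 * B) powr p) * indicator {-(B+1)..B+1} x"])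
    have "(\<integral>\<^sup>+x. ennreal ((2 * B) powr p) * indicator {-(B+1)..B+1} x \<partial>bessel_measure \<nu>) =
        ennreal ((2 * B) powr p) * (\<integral>\<^sup>+x. indicator {-(B+1)..B+1} x \<partial>bessel_measure \<nu>)"
      by (rule nn_integral_cmult) (intro borel_imp_measurable_bessel, measurable)
    also have "\<dots> < \<infinity>"
      using emeasure_bessel_Icc_finite[OF \<nu>, of "B+1"] B by (simp add: ennreal_mult_less_top)
    finally show "(\<integral>\<^sup>+x. ennreal ((2 * B) powr p) * indicator {-(B+1)..B+1} x \<partial>bessel_measure \<nu>) < \<infinity>" .
    show "AE x in bessel_measure \<nu>. ennreal (norm (h x - g n x) powr p) \<le>
        ennreal ((2 * B) powr p) * indicator {-(B+1)..B+1} x" for n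
    proof (rule AE_I2)
      fix x
      show "ennreal (norm (h x - g n x) powr p) \<le> ennreal ((2 * B) powr p) * indicator {-(B+1)..B+1} x"
      proof (cases "\<bar>x\<bar> \<le> B + 1")
        case True
        hence "x \<in> {-(B+1)..B+1}" by auto
        moreover have "norm (h x - g n x) \<le> 2 * B" using norm_triangle_ineq4[of "h x" "g n x"] hB[of x] g_le[of n x] by simp
        ultimately show ?thesis using p
          by (simp only: indicator_simps mult_1_right) (auto intro!: ennreal_leI powr_mono2)
      qed (use supp[of x] g_supp[of x n] in auto)
    qed
    show "AE x in bessel_measure \<nu>. (\<lambda>n. ennreal (norm (h x - g n x) powr p)) \<longlonglongrightarrow> 0"
      using ae
    proof eventually_elim
      fix x assume "x \<notin> N"
      hence "(\<lambda>n. norm (h x - g n x)) \<longlonglongrightarrow> 0"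
        using tendsto_norm[OF tendsto_diff[OF tendsto_const[of "h x"] g_lim[of x]]] by simp
      hence "(\<lambda>n. norm (h x - g n x) powr p) \<longlonglongrightarrow> 0 powr p"
        using p by (intro tendsto_powr') auto
      thus "(\<lambda>n. ennreal (norm (h x - g n x) powr p)) \<longlonglongrightarrow> 0"
        using p tendsto_ennrealI by fastforce
    qed
  qed (intro borel_imp_measurable_bessel; measurable)+
  hence "(\<lambda>n. Lp_energy p \<nu> (\<lambda>x. h x - g n x)) \<longlonglongrightarrow> 0" by (simp add: Lp_energy_def)
  from order_tendstoD(2)[OF this, of "ennreal e"] e
  obtain n where "Lp_energy p \<nu> (\<lambda>x. h x - g n x) < ennreal e"
    by (auto simp: eventually_sequentially)
  thus thesis using that[OF g_cont[of n] g_supp] by auto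
qed

lemma Lp_continuous_dense:
  assumes \<nu>: "\<nu> > - 1 / 2" and p: "p \<ge> 1" and f [measurable]: "f \<in> borel_measurable borel"
    and fin: "Lp_energy p \<nu> f < \<infinity>" and e: "e > (0::real)"
  obtains g R where "continuous_on UNIV g" "R \<ge> 0" "\<And>x. \<bar>x\<bar> > R \<Longrightarrow> g x = 0"
    "Lp_energy p \<nu> (\<lambda>x. f x - g x) \<le> ennreal e"
proof -
  define d where "d = e / (2 * 2 powr p)"
  have d: "d > 0" "2 powr p * (d + d) = e" using e by (auto simp: d_def field_simps)
  obtain B h where h: "B > 0" "h \<in> borel_measurable borel" "\<And>x. norm (h x) \<le> B" "\<And>x. \<bar>x\<bar> > B \<Longrightarrow> h x = 0"
    "Lp_energy p \<nu> (\<lambda>x. f x - h x) \<le> ennreal d"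
    using Lp_truncation[OF p f fin d(1)] by metis
  obtain g where g: "continuous_on UNIV g" "\<And>x. \<bar>x\<bar> > B + 1 \<Longrightarrow> g x = 0"
    "Lp_energy p \<nu> (\<lambda>x. h x - g x) \<le> ennreal d"
    using Lp_continuous_approximation_bounded[OF \<nu> p h(1-4) d(1)] by metis
  have [measurable]: "g \<in> borel_measurable borel" "h \<in> borel_measurable borel"
    using g(1) h(2) by (auto intro: borel_measurable_continuous_onI)
  have "Lp_energy p \<nu> (\<lambda>x. f x - g x) = Lp_energy p \<nu> (\<lambda>x. (f x - h x) + (h x - g x))" by simp
  also have "\<dots> \<le> ennreal (2 powr p) * (Lp_energy p \<nu> (\<lambda>x. f x - h x) + Lp_energy p \<nu> (\<lambda>x. h x - g x))"
    by (intro Lp_energy_add p borel_imp_measurable_bessel; measurable)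
  also have "\<dots> \<le> ennreal (2 powr p) * (ennreal d + ennreal d)"
    by (intro mult_left_mono add_mono h g) auto
  also have "\<dots> = ennreal e"
    using d by (simp add: ennreal_plus[symmetric] ennreal_mult[symmetric] del: ennreal_plus)
  finally show thesis using that[of g "B + 1"] g(1,2) h(1) by auto
qed

section \<open>Strong continuity of the Bessel translation\<close>

lemma Lp_energy_diff:
  assumes p: "p \<ge> 1" and [measurable]: "f \<in> borel_measurable (bessel_measure \<nu>)" "g \<in> borel_measurable (bessel_measure \<nu>)"
  shows "Lp_energy p \<nu> (\<lambda>x. f x - g x) \<le> ennreal (2 powr p) * (Lp_energy p \<nu> f + Lp_energy p \<nu> g)"
  using Lp_energy_add[OF p, of f \<nu> "\<lambda>x. - g x"] by (simp add: Lp_energy_def)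

text \<open>The usual density argument: with \<open>g\<close> continuous of compact support and close to \<open>f\<close>, split
  \<open>T f - f = T (f - g) + (T g - g) + (g - f)\<close>, where the contraction property bounds the first term.\<close>

lemma angular_average_Lp_continuous:
  assumes \<nu>: "\<nu> > - 1 / 2" and p: "p \<ge> 1" and f [measurable]: "f \<in> borel_measurable borel"
    and fin: "Lp_energy p \<nu> f < \<infinity>" and e: "e > (0::real)"
  shows "eventually (\<lambda>y. Lp_energy p \<nu> (\<lambda>x. angular_average \<nu> y f x - f x) \<le> ennreal e) (at 0)"
proof -
  interpret finite_measure "angular_measure \<nu>"
    by (rule finite_measureI) (simp add: emeasure_angular_measure_UNIV[OF \<nu>])
  define C :: real where "C = 2 powr p"
  have C: "C > 0" by (simp add: C_def)
  \<comment> \<open>Two applications of \<open>Lp_energy_add\<close> to terms of energy \<open>d\<close> give \<open>C * (d + C * (d + d))\<close>.\<close>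
  define d where "d = e / (C + 2 * C\<^sup>2)"
  have C2: "C + 2 * C\<^sup>2 > 0" using C by (intro add_pos_pos) auto
  have d: "d > 0" using e C2 by (simp add: d_def)
  have dC: "C * (d + C * (d + d)) = e"
  proof -
    have "C * (d + C * (d + d)) = d * (C + 2 * C\<^sup>2)" by (simp add: power2_eq_square algebra_simps)
    thus ?thesis using C2 by (simp add: d_def)
  qed
  obtain g R where g: "continuous_on UNIV g" "R \<ge> 0" "\<And>x. \<bar>x\<bar> > R \<Longrightarrow> g x = 0"
    and fg: "Lp_energy p \<nu> (\<lambda>x. f x - g x) \<le> ennreal d"
    using Lp_continuous_dense[OF \<nu> p f fin d] by metis
  have [measurable]: "g \<in> borel_measurable borel"
    using g(1) by (rule borel_measurable_continuous_onI)
  have "bounded (g ` {-R..R})"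
    by (intro compact_imp_bounded compact_continuous_image continuous_on_subset[OF g(1)]) auto
  then obtain K where K: "\<forall>z\<in>g ` {-R..R}. norm z \<le> K"
    unfolding bounded_iff by blast
  have gK: "norm (g x) \<le> max K 0" for x
  proof (cases "\<bar>x\<bar> > R")
    case False
    hence "x \<in> {-R..R}" by auto
    thus ?thesis using K by (auto simp: le_max_iff_disj)
  qed (use g(3) in simp)
  have [measurable]: "angular_average \<nu> y f \<in> borel_measurable borel"
    "angular_average \<nu> y g \<in> borel_measurable borel" for y
    by (intro angular_average_measurable \<nu>; measurable)+
  have "eventually (\<lambda>y. Lp_energy p \<nu> (\<lambda>x. angular_average \<nu> y g x - g x) \<le> ennreal d) (at 0)"
    by (rule Lp_energy_average_compact_support[OF \<nu> p g(1) g(3) g(2) d])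
  thus ?thesis
  proof eventually_elim
    fix y :: real assume y: "Lp_energy p \<nu> (\<lambda>x. angular_average \<nu> y g x - g x) \<le> ennreal d"
    \<comment> \<open>Linearity needs integrability over the angle, which holds for almost every \<open>x\<close> only.\<close>
    have "AE x in bessel_measure \<nu>. angular_average \<nu> y f x - angular_average \<nu> y g x =
        angular_average \<nu> y (\<lambda>s. f s - g s) x"
      using AE_integrable_chord[OF \<nu> p f fin, of y]
    proof eventually_elim
      fix x assume "integrable (angular_measure \<nu>) (\<lambda>\<theta>. f (chord y x \<theta>))"
      moreover have "integrable (angular_measure \<nu>) (\<lambda>\<theta>. g (chord y x \<theta>))"
        by (rule integrable_const_bound[of _ "max K 0"]) (auto simp: gK)
      ultimately show "angular_average \<nu> y f x - angular_average \<nu> y g x = angular_average \<nu> y (\<lambda>s. f s - g s) x"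
        by (simp add: angular_average_def)
    qed
    hence "Lp_energy p \<nu> (\<lambda>x. angular_average \<nu> y f x - angular_average \<nu> y g x) =
        Lp_energy p \<nu> (angular_average \<nu> y (\<lambda>s. f s - g s))"
      by (rule Lp_energy_cong_AE)
    also have "\<dots> \<le> Lp_energy p \<nu> (\<lambda>s. f s - g s)"
      by (rule Lp_energy_average_le[OF \<nu> p]) measurable
    also note fg
    finally have Tfg: "Lp_energy p \<nu> (\<lambda>x. angular_average \<nu> y f x - angular_average \<nu> y g x) \<le> ennreal d" .
    have gf: "Lp_energy p \<nu> (\<lambda>x. g x - f x) \<le> ennreal d"
      using fg by (simp add: Lp_energy_def norm_minus_commute)
    have "Lp_energy p \<nu> (\<lambda>x. angular_average \<nu> y f x - f x) =
      Lp_energy p \<nu> (\<lambda>x. (angular_average \<nu> y f x - angular_average \<nu> y g x) +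
        ((angular_average \<nu> y g x - g x) + (g x - f x)))" by simp
    also have "\<dots> \<le> ennreal C * (Lp_energy p \<nu> (\<lambda>x. angular_average \<nu> y f x - angular_average \<nu> y g x) +
        Lp_energy p \<nu> (\<lambda>x. (angular_average \<nu> y g x - g x) + (g x - f x)))"
      unfolding C_def by (intro Lp_energy_add p borel_imp_measurable_bessel; measurable)
    also have "\<dots> \<le> ennreal C * (Lp_energy p \<nu> (\<lambda>x. angular_average \<nu> y f x - angular_average \<nu> y g x) +
        ennreal C * (Lp_energy p \<nu> (\<lambda>x. angular_average \<nu> y g x - g x) + Lp_energy p \<nu> (\<lambda>x. g x - f x)))"
      unfolding C_def by (intro mult_left_mono add_left_mono Lp_energy_add p borel_imp_measurable_bessel; (measurable | simp))
    also have "\<dots> \<le> ennreal C * (ennreal d + ennreal C * (ennreal d + ennreal d))"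
      by (intro mult_left_mono add_mono Tfg y gf) auto
    also have "\<dots> = ennreal e"
      using d C by (simp add: ennreal_plus[symmetric] ennreal_mult[symmetric] dC[folded mult_2] del: ennreal_plus)
    finally show "Lp_energy p \<nu> (\<lambda>x. angular_average \<nu> y f x - f x) \<le> ennreal e" .
  qed
qed

lemma tendsto_zero_ennrealI:
  fixes f :: "'a \<Rightarrow> ennreal"
  assumes "\<And>e. e > (0::real) \<Longrightarrow> eventually (\<lambda>y. f y \<le> ennreal e) F"
  shows "(f \<longlongrightarrow> 0) F"
proof (rule order_tendstoI)
  fix a :: ennreal assume "0 < a"
  then obtain q where q: "0 < q" "q < a" using dense by blast
  then obtain e where e: "q = ennreal e" "e > 0" by (cases q) auto
  from assms[OF e(2)] show "eventually (\<lambda>y. f y < a) F"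
    by eventually_elim (use q e in auto)
qed auto

lemma bessel_translation_Lp:
  assumes \<nu>: "\<nu> > - 1 / 2" and p: "p \<ge> 1" and f: "f \<in> borel_measurable (bessel_measure \<nu>)"
    and fin: "Lp_energy p \<nu> f < \<infinity>"
  shows bessel_translation_measurable: "bessel_translation \<nu> y f \<in> borel_measurable (bessel_measure \<nu>)"
    and bessel_translation_contraction: "Lp_energy p \<nu> (bessel_translation \<nu> y f) \<le> Lp_energy p \<nu> f"
    and bessel_translation_Lp_continuous:
      "((\<lambda>y. Lp_energy p \<nu> (\<lambda>x. bessel_translation \<nu> y f x - f x)) \<longlongrightarrow> 0) (at 0)"
proof -
  obtain f' where f': "f' \<in> borel_measurable borel" and ff': "AE x in bessel_measure \<nu>. f x = f' x"
    using bessel_borel_representative[OF f] by metis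
  note T = bessel_translation_cong_AE[OF \<nu> f' ff']
  have E: "Lp_energy p \<nu> f = Lp_energy p \<nu> f'" by (rule Lp_energy_cong_AE[OF ff'])
  show "bessel_translation \<nu> y f \<in> borel_measurable (bessel_measure \<nu>)"
    by (rule borel_measurable_bessel_AE[OF angular_average_measurable[OF \<nu> f'] T])
  show "Lp_energy p \<nu> (bessel_translation \<nu> y f) \<le> Lp_energy p \<nu> f"
    unfolding E Lp_energy_cong_AE[OF T] by (rule Lp_energy_average_le[OF \<nu> p f'])
  have "Lp_energy p \<nu> (\<lambda>x. bessel_translation \<nu> y f x - f x) =
      Lp_energy p \<nu> (\<lambda>x. angular_average \<nu> y f' x - f' x)" for y
    by (rule Lp_energy_cong_AE) (use T[of y] ff' in eventually_elim, simp)
  thus "((\<lambda>y. Lp_energy p \<nu> (\<lambda>x. bessel_translation \<nu> y f x - f x)) \<longlongrightarrow> 0) (at 0)"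
    using angular_average_Lp_continuous[OF \<nu> p f'] fin by (auto intro!: tendsto_zero_ennrealI simp: E)
qed

lemma Lp_bessel_iff:
  "f \<in> Lp_bessel p \<nu> \<longleftrightarrow> f \<in> borel_measurable (bessel_measure \<nu>) \<and> Lp_energy p \<nu> f < \<infinity>"
  unfolding Lp_bessel_def Lp_energy_def by (auto simp: integrable_iff_bounded)

lemma Lp_bessel_norm_eq:
  assumes "f \<in> borel_measurable (bessel_measure \<nu>)"
  shows "Lp_bessel_norm p \<nu> f = enn2real (Lp_energy p \<nu> f) powr (1 / p)"
  unfolding Lp_bessel_norm_def Lp_energy_def
  using assms by (subst integral_eq_nn_integral) auto

section \<open>The translation associated with a matrix\<close>

definition chirp :: "real \<Rightarrow> real \<Rightarrow> complex" where
  "chirp k t = exp (\<i> / 2 * complex_of_real (k * t))"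

lemma norm_chirp [simp]: "norm (chirp k t) = 1"
  by (simp add: chirp_def)

lemma continuous_chirp: "continuous_on UNIV (chirp k)"
  unfolding chirp_def by (intro continuous_intros)

lemma chirp_add: "chirp k (s + t) = chirp k s * chirp k t"
  by (simp add: chirp_def distrib_left exp_add)

text \<open>With \<open>g\<close> the demodulated function, \<open>f x = chirp k (x\<^sup>2) * g x\<close>. The error thus splits into the error of
  the Bessel translation of \<open>g\<close>, rotated by a factor of modulus \<open>1\<close>, and a multiple of \<open>f\<close> by a
  scalar that depends on \<open>y\<close> only.\<close>

lemma canonical_translation_diff:
  fixes m :: "real^2^2"
  defines "k \<equiv> m $ 2 $ 2 / m $ 1 $ 2"
  defines "g \<equiv> \<lambda>f s. chirp k (- s\<^sup>2) * f s"
  shows "canonical_translation \<nu> m y f x - f x =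
    chirp k (x\<^sup>2 + y\<^sup>2) * (bessel_translation \<nu> y (g f) x - g f x) + (chirp k (y\<^sup>2) - 1) * f x"
proof -
  have "canonical_translation \<nu> m y f x = chirp k (x\<^sup>2 + y\<^sup>2) * bessel_translation \<nu> y (g f) x"
    by (simp add: canonical_translation_def Let_def chirp_def g_def k_def)
  moreover have "chirp k (x\<^sup>2 + y\<^sup>2) * g f x = chirp k (y\<^sup>2) * f x"
    by (simp add: g_def mult.assoc[symmetric] chirp_add[symmetric])
  ultimately show ?thesis by (simp add: algebra_simps)
qed

lemma tendsto_chirp_square: "((\<lambda>y. norm (chirp k (y\<^sup>2) - 1)) \<longlongrightarrow> 0) (at 0)"
proof -
  have "isCont (\<lambda>y. norm (chirp k (y\<^sup>2) - 1)) 0"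
    unfolding chirp_def by (intro continuous_intros)
  thus ?thesis unfolding isCont_def by (simp add: chirp_def)
qed

lemma canonical_translation_C0:
  fixes m :: "real^2^2"
  assumes \<nu>: "\<nu> > - 1 / 2" and f: "f \<in> even_C0"
  shows "((\<lambda>y. sup_norm (\<lambda>x. canonical_translation \<nu> m y f x - f x)) \<longlongrightarrow> 0) (at 0)"
proof (rule tendsto_zero_ennrealI)
  fix e :: real assume e: "e > 0"
  define k where "k = m $ 2 $ 2 / m $ 1 $ 2"
  define g where "g s = chirp k (- s\<^sup>2) * f s" for s
  have f: "\<And>x. f (- x) = f x" "continuous_on UNIV f" "(f \<longlongrightarrow> 0) at_infinity"
    using f by (auto simp: even_C0_def)
  have g_cont: "continuous_on UNIV g"
    unfolding g_def using f(2) by (intro continuous_intros continuous_on_compose2[OF continuous_chirp]) auto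
  have g_lim: "(g \<longlongrightarrow> 0) at_infinity"
    by (rule tendsto_norm_zero_cancel) (use tendsto_norm_zero[OF f(3)] in \<open>simp add: g_def norm_mult\<close>)
  have g_even: "g \<bar>x\<bar> = g x" for x
    using f(1)[of x] by (auto simp: g_def abs_if)
  have "eventually (\<lambda>x. dist (f x) 0 < 1) at_infinity"
    using f(3) by (intro tendstoD) auto
  then obtain R where R: "\<And>x. R \<le> norm x \<Longrightarrow> norm (f x) < 1"
    by (auto simp: eventually_at_infinity)
  have "bounded (f ` cball 0 R)"
    by (intro compact_imp_bounded compact_continuous_image continuous_on_subset[OF f(2)]) auto
  then obtain K where K: "\<forall>z\<in>f ` cball 0 R. norm z \<le> K"
    unfolding bounded_iff by blast
  define M where "M = max K 1"
  have fM: "norm (f x) \<le> M" for x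
    using K R[of x] by (cases "norm x \<le> R") (auto simp: M_def le_max_iff_disj)
  have M: "M > 0" by (auto simp: M_def)
  have "e / 2 > 0" using e by simp
  then obtain \<delta> where \<delta>: "\<delta> > 0" "\<And>y x. \<bar>y\<bar> < \<delta> \<Longrightarrow> norm (angular_average \<nu> y g x - g \<bar>x\<bar>) \<le> e / 2"
    using angular_average_uniform[OF \<nu> uniformly_continuous_vanishing_at_infinity[OF g_cont g_lim]]
    by metis
  have "eventually (\<lambda>y. dist y 0 < \<delta>) (at (0::real))"
    unfolding eventually_at using \<delta>(1) by (intro exI[of _ \<delta>]) auto
  moreover have "eventually (\<lambda>y. norm (chirp k (y\<^sup>2) - 1) < e / (2 * M)) (at 0)"
    by (rule order_tendstoD(2)[OF tendsto_chirp_square]) (use e M in simp)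
  ultimately show "eventually (\<lambda>y. sup_norm (\<lambda>x. canonical_translation \<nu> m y f x - f x) \<le> ennreal e) (at 0)"
  proof eventually_elim
    fix y :: real assume y: "dist y 0 < \<delta>" "norm (chirp k (y\<^sup>2) - 1) < e / (2 * M)"
    have "norm (canonical_translation \<nu> m y f x - f x) \<le> e" for x
    proof -
      have T: "bessel_translation \<nu> y g x = angular_average \<nu> y g x"
        using g_cont by (intro bessel_translation_eq_average \<nu> borel_measurable_continuous_onI)
      have "canonical_translation \<nu> m y f x - f x =
          chirp k (x\<^sup>2 + y\<^sup>2) * (angular_average \<nu> y g x - g \<bar>x\<bar>) + (chirp k (y\<^sup>2) - 1) * f x"
        unfolding T[symmetric] g_even canonical_translation_diff k_def[symmetric] g_def[symmetric] ..
      also have "norm \<dots> \<le> norm (angular_average \<nu> y g x - g \<bar>x\<bar>) + norm (chirp k (y\<^sup>2) - 1) * norm (f x)"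
        by (rule order_trans[OF norm_triangle_ineq]) (simp add: norm_mult)
      also have "\<dots> \<le> e / 2 + e / (2 * M) * M"
        using y fM[of x] e M by (intro add_mono mult_mono \<delta>(2)) auto
      also have "\<dots> = e" using M by simp
      finally show ?thesis .
    qed
    thus "sup_norm (\<lambda>x. canonical_translation \<nu> m y f x - f x) \<le> ennreal e"
      unfolding sup_norm_def by (intro SUP_least ennreal_leI)
  qed
qed

lemma canonical_translation_Lp:
  fixes m :: "real^2^2"
  assumes \<nu>: "\<nu> > - 1 / 2" and p: "p \<ge> 1" and f: "f \<in> Lp_bessel p \<nu>"
  shows "(\<lambda>x. canonical_translation \<nu> m y f x - f x) \<in> Lp_bessel p \<nu>"
    and "((\<lambda>y. Lp_bessel_norm p \<nu> (\<lambda>x. canonical_translation \<nu> m y f x - f x)) \<longlongrightarrow> 0) (at 0)"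
proof -
  define k where "k = m $ 2 $ 2 / m $ 1 $ 2"
  define g where "g s = chirp k (- s\<^sup>2) * f s" for s
  have f [measurable]: "f \<in> borel_measurable (bessel_measure \<nu>)" and fin: "Lp_energy p \<nu> f < \<infinity>"
    using f by (auto simp: Lp_bessel_iff)
  have chirp_meas: "(\<lambda>x. chirp k (q x)) \<in> borel_measurable (bessel_measure \<nu>)"
    if "continuous_on UNIV q" for q
    using that by (intro borel_imp_measurable_bessel borel_measurable_continuous_onI
      continuous_on_compose2[OF continuous_chirp]) auto
  have [measurable]: "(\<lambda>x. chirp k (x\<^sup>2 + y\<^sup>2)) \<in> borel_measurable (bessel_measure \<nu>)" for y
    by (intro chirp_meas continuous_intros)
  have [measurable]: "(\<lambda>x. chirp k (- x\<^sup>2)) \<in> borel_measurable (bessel_measure \<nu>)"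
    by (intro chirp_meas continuous_intros)
  have g [measurable]: "g \<in> borel_measurable (bessel_measure \<nu>)"
    unfolding g_def by measurable
  have g_fin: "Lp_energy p \<nu> g < \<infinity>"
    using fin by (simp add: Lp_energy_def g_def norm_mult)
  note [measurable] = bessel_translation_measurable[OF \<nu> p g g_fin]
  let ?D = "\<lambda>y x. canonical_translation \<nu> m y f x - f x"
  let ?a = "\<lambda>y. Lp_energy p \<nu> (\<lambda>x. bessel_translation \<nu> y g x - g x)"
  have D: "?D y x = chirp k (x\<^sup>2 + y\<^sup>2) * (bessel_translation \<nu> y g x - g x) + (chirp k (y\<^sup>2) - 1) * f x" for x y
    unfolding canonical_translation_diff k_def[symmetric] g_def[symmetric] ..
  have D_meas [measurable]: "?D y \<in> borel_measurable (bessel_measure \<nu>)" for y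
    unfolding D by measurable
  define b where "b y = ennreal (2 powr p) * (?a y + Lp_energy p \<nu> f * ennreal (norm (chirp k (y\<^sup>2) - 1) powr p))" for y
  have D_le: "Lp_energy p \<nu> (?D y) \<le> b y" for y
  proof -
    have "Lp_energy p \<nu> (?D y) \<le> ennreal (2 powr p) *
       (Lp_energy p \<nu> (\<lambda>x. chirp k (x\<^sup>2 + y\<^sup>2) * (bessel_translation \<nu> y g x - g x)) +
        Lp_energy p \<nu> (\<lambda>x. (chirp k (y\<^sup>2) - 1) * f x))"
      unfolding D by (intro Lp_energy_add p; measurable)
    also have "Lp_energy p \<nu> (\<lambda>x. chirp k (x\<^sup>2 + y\<^sup>2) * (bessel_translation \<nu> y g x - g x)) = ?a y"
      by (simp add: Lp_energy_def norm_mult)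
    also have "Lp_energy p \<nu> (\<lambda>x. (chirp k (y\<^sup>2) - 1) * f x) =
        Lp_energy p \<nu> f * ennreal (norm (chirp k (y\<^sup>2) - 1) powr p)"
      unfolding Lp_energy_def
      by (subst nn_integral_multc[symmetric]) (auto simp: norm_mult powr_mult ennreal_mult mult.commute)
    finally show ?thesis by (simp add: b_def)
  qed
  have a_fin: "?a y < \<infinity>" for y
  proof -
    have "?a y \<le> ennreal (2 powr p) * (Lp_energy p \<nu> (bessel_translation \<nu> y g) + Lp_energy p \<nu> g)"
      by (intro Lp_energy_diff p; measurable)
    also have "\<dots> \<le> ennreal (2 powr p) * (Lp_energy p \<nu> g + Lp_energy p \<nu> g)"
      by (intro mult_left_mono add_mono bessel_translation_contraction[OF \<nu> p g g_fin]) auto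
    also have "\<dots> < \<infinity>" using g_fin by (simp add: ennreal_mult_less_top)
    finally show ?thesis .
  qed
  have b_fin: "b y < \<infinity>" for y
    using a_fin[of y] fin by (simp add: b_def ennreal_mult_less_top)
  show "?D y \<in> Lp_bessel p \<nu>"
    using D_meas D_le[of y] b_fin[of y] by (auto simp: Lp_bessel_iff)
  have "((\<lambda>y. norm (chirp k (y\<^sup>2) - 1) powr p) \<longlongrightarrow> 0 powr p) (at 0)"
    using p by (intro tendsto_powr' tendsto_chirp_square tendsto_const) auto
  hence "((\<lambda>y. ennreal (norm (chirp k (y\<^sup>2) - 1) powr p)) \<longlongrightarrow> ennreal 0) (at 0)"
    using p by (intro tendsto_ennrealI) simp
  hence "(b \<longlongrightarrow> ennreal (2 powr p) * (0 + Lp_energy p \<nu> f * ennreal 0)) (at 0)"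
    unfolding b_def using fin
    by (intro ennreal_tendsto_cmult tendsto_add bessel_translation_Lp_continuous[OF \<nu> p g g_fin]) auto
  hence b0: "(b \<longlongrightarrow> 0) (at 0)" by simp
  have "((\<lambda>y. Lp_energy p \<nu> (?D y)) \<longlongrightarrow> 0) (at 0)"
    by (rule tendsto_sandwich[OF _ _ tendsto_const b0]) (auto simp: D_le)
  hence "((\<lambda>y. enn2real (Lp_energy p \<nu> (?D y))) \<longlongrightarrow> 0) (at 0)"
    by (intro tendsto_enn2real) auto
  hence "((\<lambda>y. enn2real (Lp_energy p \<nu> (?D y)) powr (1 / p)) \<longlongrightarrow> 0 powr (1 / p)) (at 0)"
    using p by (intro tendsto_powr' tendsto_const) auto
  thus "((\<lambda>y. Lp_bessel_norm p \<nu> (?D y)) \<longlongrightarrow> 0) (at 0)"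
    using p by (simp add: Lp_bessel_norm_eq[OF D_meas])
qed

theorem theorem3p2:
  fixes \<nu> :: real and m :: "real^2^2"
  assumes "\<nu> > - 1 / 2" and "det m = 1" and "m $ 1 $ 2 \<noteq> 0"
  shows "(\<forall>f \<in> even_C0.
            ((\<lambda>y. sup_norm (\<lambda>x. canonical_translation \<nu> m y f x - f x)) \<longlongrightarrow> 0) (at 0))
       \<and> (\<forall>p \<ge> 1. \<forall>f \<in> Lp_bessel p \<nu>.
            (\<forall>y. (\<lambda>x. canonical_translation \<nu> m y f x - f x) \<in> Lp_bessel p \<nu>) \<and>
            ((\<lambda>y. Lp_bessel_norm p \<nu> (\<lambda>x. canonical_translation \<nu> m y f x - f x)) \<longlongrightarrow> 0) (at 0))"
  using canonical_translation_C0[OF assms(1)] canonical_translation_Lp[OF assms(1)] by blast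

end
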